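(* Let $\mathcal K$ be a 3-dimensional simplicial complex embedded in $\mathbb R^3$ triangulating a closed bounded domain with Lipschitz boundary that is homeomorphic to a closed 3-ball. Then there exists a spanning tree of the 1-skeleton of $\mathcal K$ for which the Spanning Tree Technique (STT) terminates if and only if $\mathcal K$ is collapsible.
   Context: Simplices of $\mathcal K$ are oriented; $\mathbf C$ is the face–edge incidence matrix ($\pm1$ if $e\subset\partial f$ with sign given by orientations, $0$ otherwise). STT with input a spanning tree $T$ of the graph of vertices and edges of $\mathcal K$ (for a given face array $\mathbf i$): set $\mathbf h_e=0$ for edges $e$ of $T$, other edge values unknown; put all triangles in a list $L$; repeatedly choose a triangle $f\in L$ with two boundary edges $e_1,e_2$ of known value, set the value of its remaining boundary edge $e$ to $\mathbf h_e=(\mathbf C_{f,e})^{-1}(\mathbf i_f-\mathbf C_{f,e_1}\mathbf h_{e_1}-\mathbf C_{f,e_2}\mathbf h_{e_2})$, and remove $f$ from $L$. STT terminates if it never gets stuck with edges of unknown value remaining and no such triangle available, i.e. every edge eventually receives a value. An elementary collapse removes a pair $(\sigma,\tau)$ of cells with $\sigma\subset\tau$, $\dim\sigma=\dim\tau-1$, $\tau$ the only cell properly containing $\sigma$; $\mathcal K$ is collapsible if a finite sequence of elementary collapses reduces it to a single vertex. *)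

theory Defs
  imports "HOL-Analysis.Analysis"
begin

text \<open>Geometric simplicial complexes in R^3 are represented as in HOL-Analysis
  (Polytope.thy): a complex is a finite set of geometric simplices (convex hulls of
  affinely independent point sets), closed under faces, pairwise meeting in a common face.
  The library notion includes the empty face; cells are the nonempty members.\<close>

type_synonym pt = "real^3"

definition cells :: "pt set set \<Rightarrow> pt set set" where
  "cells K = K - {{}}"

definition simplicial_complex3 :: "pt set set \<Rightarrow> bool" where
  "simplicial_complex3 K \<longleftrightarrow> simplicial_complex K
     \<and> (\<forall>S\<in>K. aff_dim S \<le> 3) \<and> (\<exists>S\<in>K. aff_dim S = 3)"

text \<open>Closed bounded domain: compact, the closure of its (connected) interior.\<close>
definition closed_bounded_domain :: "pt set \<Rightarrow> bool" where
  "closed_bounded_domain \<Omega> \<longleftrightarrow> compact \<Omega> \<and> connected (interior \<Omega>) \<and> \<Omega> = closure (interior \<Omega>)"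

text \<open>Lipschitz boundary: locally, after a rigid rotation, the domain is the subgraph
  of a Lipschitz function of two variables.\<close>
definition lipschitz_boundary :: "pt set \<Rightarrow> bool" where
  "lipschitz_boundary \<Omega> \<longleftrightarrow>
     (\<forall>x\<in>frontier \<Omega>. \<exists>r>0. \<exists>(Q :: pt \<Rightarrow> pt) (L :: real) (g :: real \<times> real \<Rightarrow> real).
        orthogonal_transformation Q \<and> L-lipschitz_on UNIV g \<and>
        \<Omega> \<inter> ball x r = {y \<in> ball x r. (Q y)$3 \<le> g ((Q y)$1, (Q y)$2)})"

definition vertices :: "pt set set \<Rightarrow> pt set" where
  "vertices K = {v. {v} \<in> K}"

definition edges :: "pt set set \<Rightarrow> pt set set" where
  "edges K = {e\<in>K. aff_dim e = 1}"

definition triangles :: "pt set set \<Rightarrow> pt set set" where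
  "triangles K = {f\<in>K. aff_dim f = 2}"

definition boundary_edges :: "pt set \<Rightarrow> pt set set" where
  "boundary_edges f = {e. e face_of f \<and> aff_dim e = 1}"

text \<open>Graph of vertices and edges; an edge joins its two endpoints.\<close>
definition adj :: "pt set set \<Rightarrow> (pt \<times> pt) set" where
  "adj T = {(a,b). a \<noteq> b \<and> closed_segment a b \<in> T}"

definition has_cycle :: "pt set set \<Rightarrow> bool" where
  "has_cycle T \<longleftrightarrow> (\<exists>vs. distinct vs \<and> length vs \<ge> 3 \<and>
      (\<forall>i<length vs. (vs ! i, vs ! ((i + 1) mod length vs)) \<in> adj T))"

definition spanning_tree :: "pt set set \<Rightarrow> pt set set \<Rightarrow> bool" where
  "spanning_tree K T \<longleftrightarrow> T \<subseteq> edges K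
     \<and> (\<forall>u\<in>vertices K. \<forall>v\<in>vertices K. (u, v) \<in> (adj T)\<^sup>*)
     \<and> \<not> has_cycle T"

text \<open>One step of STT on states (set of edges with known value, list L of remaining
  triangles). Only which edges are known matters for termination, since the
  coefficients C_{f,e} are +-1 and hence invertible; the numeric values are omitted.\<close>
definition stt_step :: "pt set set \<Rightarrow> (pt set set \<times> pt set set) \<Rightarrow> (pt set set \<times> pt set set) \<Rightarrow> bool" where
  "stt_step K s s' \<longleftrightarrow> (\<exists>f\<in>snd s. \<exists>e1 e2 e.
      boundary_edges f = {e1, e2, e} \<and> distinct [e1, e2, e] \<and>
      e1 \<in> fst s \<and> e2 \<in> fst s \<and>
      s' = (insert e (fst s), snd s - {f}))"

text \<open>STT terminates: it never gets stuck while some edge is still of unknown value.\<close>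
definition stt_terminates :: "pt set set \<Rightarrow> pt set set \<Rightarrow> bool" where
  "stt_terminates K T \<longleftrightarrow>
     (\<forall>s. (stt_step K)\<^sup>*\<^sup>* (T, triangles K) s \<and> \<not> (\<exists>s'. stt_step K s s')
          \<longrightarrow> edges K \<subseteq> fst s)"

definition elementary_collapse :: "pt set set \<Rightarrow> pt set set \<Rightarrow> bool" where
  "elementary_collapse C C' \<longleftrightarrow> (\<exists>\<sigma> \<tau>. \<sigma> \<in> C \<and> \<tau> \<in> C \<and> \<sigma> \<subset> \<tau> \<and>
      aff_dim \<sigma> = aff_dim \<tau> - 1 \<and> (\<forall>\<rho>\<in>C. \<sigma> \<subset> \<rho> \<longrightarrow> \<rho> = \<tau>) \<and>
      C' = C - {\<sigma>, \<tau>})"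

definition collapsible :: "pt set set \<Rightarrow> bool" where
  "collapsible K \<longleftrightarrow> (\<exists>v. elementary_collapse\<^sup>*\<^sup>* (cells K) {{v}})"

end

theory Submission
  imports Defs "HOL-Library.Z2"
begin

text \<open>
  A collapse of \<open>K\<close> to a vertex matches vertices with edges, edges with triangles and triangles with
  tetrahedra. The edges matched with vertices form a spanning tree, and reading the collapse
  backwards, each edge matched with a triangle is computed by STT from that triangle.

  Conversely, let \<open>F\<close> be the triangles through which STT determines the edges outside \<open>T\<close>. Undoing
  STT collapses the 1-skeleton together with \<open>F\<close> to \<open>T\<close>, hence to a vertex; it remains to collapse
  \<open>K\<close> onto the 1-skeleton with \<open>F\<close>. All chains are taken modulo two. \<open>F\<close> carries no 2-cycle, and a
  nonempty set of tetrahedra has a nonzero boundary, so as long as tetrahedra remain there is a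
  triangle outside \<open>F\<close> lying in exactly one of them, and it can be collapsed. A triangle outside \<open>F\<close>
  that survives would complete a 2-cycle, which bounds a set of tetrahedra because \<open>K\<close> is a ball;
  the order of the collapse shows that this set is empty.

  The homological facts are proved by counting cones: for five points of space, a generic point
  lies in an even number of the five tetrahedra they span. Hence for a 2-cycle \<open>z\<close> and a generic
  point \<open>x\<close>, the parity of the number of triangles \<open>f\<close> of \<open>z\<close> with \<open>x\<close> in the cone over \<open>f\<close> from \<open>p\<close>
  does not depend on \<open>p\<close>. This winding number changes exactly when \<open>x\<close> crosses \<open>z\<close>, and it vanishes
  outside \<open>K\<close> because the complement of a ball is connected; so \<open>z\<close> is the boundary of the set of
  tetrahedra where it is 1.
\<close>

section \<open>Chains modulo two\<close>

text \<open>The default simplifier setup rewrites sums of bits to boolean operations, away from the ring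
  laws.\<close>

declare add_bit_eq_xor [simp del] mult_bit_eq_and [simp del] bit_not_zero_iff [simp del]
  bit_not_one_iff [simp del]

lemma bit_add_self [simp]: "(a::bit) + a = 0"
  by (cases a) auto

lemma bit_add_eq_0_iff: "(a::bit) + b = 0 \<longleftrightarrow> a = b"
  by (cases a; cases b) auto

lemma bit_add3_eq_0_iff: "(a::bit) + (b + c) = 0 \<longleftrightarrow> b + a = c"
  by (cases a; cases b; cases c) auto

definition cofaces :: "'a set set \<Rightarrow> 'a set \<Rightarrow> 'a set set" where
  "cofaces X \<sigma> = {\<tau> \<in> X. \<sigma> \<subset> \<tau> \<and> card \<tau> = Suc (card \<sigma>)}"

text \<open>A chain is a total function on sets, in all dimensions at once. Its boundary at
  \<open>\<sigma>\<close> reads only members of \<open>X\<close> one dimension up, so values in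
  other dimensions or outside \<open>X\<close> do not affect it.\<close>

definition bdry :: "'a set set \<Rightarrow> ('a set \<Rightarrow> bit) \<Rightarrow> 'a set \<Rightarrow> bit" where
  "bdry X c \<sigma> = (\<Sum>\<tau>\<in>cofaces X \<sigma>. c \<tau>)"

abbreviation simplices :: "'a set set \<Rightarrow> nat \<Rightarrow> 'a set set" where
  "simplices X k \<equiv> {\<sigma> \<in> X. card \<sigma> = k}"

text \<open>The empty set is excluded from abstract complexes, matching \<^const>\<open>cells\<close>.\<close>

definition face_closed :: "'a set set \<Rightarrow> bool" where
  "face_closed X \<longleftrightarrow> (\<forall>S\<in>X. finite S \<and> S \<noteq> {} \<and> (\<forall>R\<subseteq>S. R \<noteq> {} \<longrightarrow> R \<in> X))"

lemma face_closedD: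
  assumes "face_closed X" "S \<in> X"
  shows "finite S" "S \<noteq> {}" "R \<subseteq> S \<Longrightarrow> R \<noteq> {} \<Longrightarrow> R \<in> X"
  using assms unfolding face_closed_def by blast+

lemma bdry_add: "bdry X (\<lambda>s. c s + d s) \<sigma> = bdry X c \<sigma> + bdry X d \<sigma>"
  by (simp add: bdry_def sum.distrib)

lemma bdry_zero: "bdry X (\<lambda>s. 0) \<sigma> = 0"
  by (simp add: bdry_def)

lemma finite_cofaces: "finite X \<Longrightarrow> finite (cofaces X \<sigma>)"
  by (simp add: cofaces_def)

lemma bdry_single:
  assumes "finite X" "\<tau> \<in> X"
  shows "bdry X (\<lambda>s. of_bool (s = \<tau>)) \<sigma> = of_bool (\<sigma> \<subset> \<tau> \<and> card \<tau> = Suc (card \<sigma>))"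
proof -
  have "bdry X (\<lambda>s. of_bool (s = \<tau>)) \<sigma> = (\<Sum>s\<in>cofaces X \<sigma>. if s = \<tau> then 1 else 0)"
    unfolding bdry_def by (rule sum.cong) auto
  also have "\<dots> = (if \<tau> \<in> cofaces X \<sigma> then 1 else 0)"
    using finite_cofaces[OF assms(1)] by (simp add: sum.delta)
  finally show ?thesis using assms by (auto simp: cofaces_def)
qed

lemma facets_eq_image:
  assumes "finite \<tau>"
  shows "{\<sigma>. \<sigma> \<subset> \<tau> \<and> card \<tau> = Suc (card \<sigma>)} = (\<lambda>v. \<tau> - {v}) ` \<tau>"
proof (intro equalityI subsetI)
  fix \<sigma> assume "\<sigma> \<in> {\<sigma>. \<sigma> \<subset> \<tau> \<and> card \<tau> = Suc (card \<sigma>)}"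
  then have *: "\<sigma> \<subset> \<tau>" "card \<tau> = Suc (card \<sigma>)" by auto
  then have "card (\<tau> - \<sigma>) = 1"
    using assms by (simp add: card_Diff_subset[OF finite_subset[OF psubset_imp_subset]] psubset_imp_subset)
  then obtain v where "\<tau> - \<sigma> = {v}" by (auto simp: card_1_singleton_iff)
  with * have "\<sigma> = \<tau> - {v}" "v \<in> \<tau>" by auto
  then show "\<sigma> \<in> (\<lambda>v. \<tau> - {v}) ` \<tau>" by blast
next
  fix \<sigma> assume "\<sigma> \<in> (\<lambda>v. \<tau> - {v}) ` \<tau>"
  then obtain v where v: "v \<in> \<tau>" "\<sigma> = \<tau> - {v}" by blast
  then have "card \<tau> = Suc (card \<sigma>)" using assms by (metis card.remove)
  with v show "\<sigma> \<in> {\<sigma>. \<sigma> \<subset> \<tau> \<and> card \<tau> = Suc (card \<sigma>)}" by blast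
qed

text \<open>Boundary and coboundary are adjoint: both sides sum \<open>c \<tau> * g \<sigma>\<close>
  over incident pairs. With \<open>k \<ge> 1\<close> all facets are nonempty, so face closure puts
  them in \<open>X\<close>.\<close>

lemma sum_bdry_mult:
  fixes g :: "'a set \<Rightarrow> bit"
  assumes X: "finite X" "face_closed X" and k: "k \<ge> 1"
  shows "(\<Sum>\<sigma>\<in>simplices X k. bdry X c \<sigma> * g \<sigma>)
       = (\<Sum>\<tau>\<in>simplices X (Suc k). c \<tau> * (\<Sum>v\<in>\<tau>. g (\<tau> - {v})))"
proof -
  have "(\<Sum>\<sigma>\<in>simplices X k. bdry X c \<sigma> * g \<sigma>)
      = (\<Sum>\<sigma>\<in>simplices X k. \<Sum>\<tau>\<in>{\<tau> \<in> simplices X (Suc k). \<sigma> \<subset> \<tau>}. c \<tau> * g \<sigma>)"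
    unfolding bdry_def sum_distrib_right
    by (intro sum.cong refl) (auto simp: cofaces_def)
  also have "\<dots> = (\<Sum>\<tau>\<in>simplices X (Suc k). \<Sum>\<sigma>\<in>{\<sigma> \<in> simplices X k. \<sigma> \<subset> \<tau>}. c \<tau> * g \<sigma>)"
    using X(1) by (intro sum.swap_restrict) auto
  also have "\<dots> = (\<Sum>\<tau>\<in>simplices X (Suc k). c \<tau> * (\<Sum>v\<in>\<tau>. g (\<tau> - {v})))"
  proof (rule sum.cong[OF refl])
    fix \<tau> assume \<tau>: "\<tau> \<in> simplices X (Suc k)"
    then have fin: "finite \<tau>" using X(2) by (auto dest: face_closedD)
    have "{\<sigma> \<in> simplices X k. \<sigma> \<subset> \<tau>} = {\<sigma>. \<sigma> \<subset> \<tau> \<and> card \<tau> = Suc (card \<sigma>)}"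
    proof -
      have "\<sigma> \<in> X" if "\<sigma> \<subset> \<tau>" "card \<tau> = Suc (card \<sigma>)" for \<sigma>
      proof -
        have "\<sigma> \<noteq> {}" using that \<tau> k by auto
        then show ?thesis using face_closedD(3)[OF X(2), of \<tau> \<sigma>] that \<tau> by auto
      qed
      then show ?thesis using \<tau> by auto
    qed
    also have "\<dots> = (\<lambda>v. \<tau> - {v}) ` \<tau>" by (rule facets_eq_image[OF fin])
    finally have "(\<Sum>\<sigma>\<in>{\<sigma> \<in> simplices X k. \<sigma> \<subset> \<tau>}. g \<sigma>) = (\<Sum>v\<in>\<tau>. g (\<tau> - {v}))"
      by (simp add: sum.reindex inj_on_def) (subst sum.reindex, auto simp: inj_on_def)
    then show "(\<Sum>\<sigma>\<in>{\<sigma> \<in> simplices X k. \<sigma> \<subset> \<tau>}. c \<tau> * g \<sigma>) = c \<tau> * (\<Sum>v\<in>\<tau>. g (\<tau> - {v}))"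
      by (simp flip: sum_distrib_left)
  qed
  finally show ?thesis .
qed

text \<open>Exactly two sets lie strictly between \<open>\<sigma>\<close> and a
  \<open>\<rho>\<close> with two more vertices, one for each added vertex, so the contribution of
  \<open>\<rho>\<close> cancels modulo two.\<close>

lemma bdry_bdry:
  assumes X: "finite X" "face_closed X" and \<sigma>: "\<sigma> \<in> X"
  shows "bdry X (bdry X c) \<sigma> = 0"
proof -
  let ?R = "{\<rho> \<in> X. \<sigma> \<subset> \<rho> \<and> card \<rho> = Suc (Suc (card \<sigma>))}"
  have fin: "finite \<sigma>" using X(2) \<sigma> by (auto dest: face_closedD)
  have "bdry X (bdry X c) \<sigma> = (\<Sum>\<tau>\<in>cofaces X \<sigma>. \<Sum>\<rho>\<in>{\<rho> \<in> ?R. \<tau> \<subset> \<rho>}. c \<rho>)"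
    unfolding bdry_def by (intro sum.cong refl) (auto simp: cofaces_def)
  also have "\<dots> = (\<Sum>\<rho>\<in>?R. \<Sum>\<tau>\<in>{\<tau> \<in> cofaces X \<sigma>. \<tau> \<subset> \<rho>}. c \<rho>)"
    using X(1) by (intro sum.swap_restrict) (auto simp: finite_cofaces)
  also have "\<dots> = (\<Sum>\<rho>\<in>?R. 0)"
  proof (rule sum.cong[OF refl])
    fix \<rho> assume \<rho>: "\<rho> \<in> ?R"
    then have fr: "finite \<rho>" using X(2) by (auto dest: face_closedD)
    have "card (\<rho> - \<sigma>) = 2"
      using \<rho> fin by (auto simp: card_Diff_subset)
    then obtain a b where ab: "\<rho> - \<sigma> = {a,b}" "a \<noteq> b" by (auto simp: card_2_iff)
    then have "a \<notin> \<sigma>" "b \<notin> \<sigma>" by auto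
    have "{\<tau> \<in> cofaces X \<sigma>. \<tau> \<subset> \<rho>} = {insert a \<sigma>, insert b \<sigma>}"
    proof (intro equalityI subsetI)
      fix \<tau> assume \<tau>: "\<tau> \<in> {\<tau> \<in> cofaces X \<sigma>. \<tau> \<subset> \<rho>}"
      then have "finite \<tau>" "\<sigma> \<subset> \<tau>" "card \<tau> = Suc (card \<sigma>)"
        using X(2) by (auto dest: face_closedD simp: cofaces_def)
      then have "\<sigma> \<in> (\<lambda>v. \<tau> - {v}) ` \<tau>" using facets_eq_image[of \<tau>] by blast
      then obtain v where "v \<in> \<tau>" "\<sigma> = \<tau> - {v}" by blast
      with \<tau> ab show "\<tau> \<in> {insert a \<sigma>, insert b \<sigma>}" by auto
    next
      fix \<tau> assume \<tau>: "\<tau> \<in> {insert a \<sigma>, insert b \<sigma>}"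
      then have "\<tau> \<subset> \<rho>" using ab \<rho> by auto
      then have "\<tau> \<in> X" using face_closedD(3)[OF X(2), of \<rho> \<tau>] \<rho> \<tau> by auto
      then show "\<tau> \<in> {\<tau> \<in> cofaces X \<sigma>. \<tau> \<subset> \<rho>}"
        using \<tau> \<open>\<tau> \<subset> \<rho>\<close> \<open>a \<notin> \<sigma>\<close> \<open>b \<notin> \<sigma>\<close> fin unfolding cofaces_def by (auto simp: card_insert_if)
    qed
    moreover have "insert a \<sigma> \<noteq> insert b \<sigma>" using ab by auto
    ultimately show "(\<Sum>\<tau>\<in>{\<tau> \<in> cofaces X \<sigma>. \<tau> \<subset> \<rho>}. c \<rho>) = 0" by simp
  qed
  finally show ?thesis by simp
qed

section \<open>Trees\<close>

definition graph_rel :: "'a set set \<Rightarrow> ('a \<times> 'a) set" where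
  "graph_rel T = {(a, b). a \<noteq> b \<and> {a, b} \<in> T}"

text \<open>The formula of \<open>has_cycle\<close> over an arbitrary relation, so that cycles of
  \<open>adj\<close> and of \<open>graph_rel\<close> are identified as soon as the relations
  agree.\<close>

definition cyclic_rel :: "('a \<times> 'a) set \<Rightarrow> bool" where
  "cyclic_rel r \<longleftrightarrow> (\<exists>vs. distinct vs \<and> length vs \<ge> 3 \<and>
      (\<forall>i<length vs. (vs ! i, vs ! ((i + 1) mod length vs)) \<in> r))"

lemma graph_rel_mono: "S \<subseteq> T \<Longrightarrow> graph_rel S \<subseteq> graph_rel T"
  by (auto simp: graph_rel_def)

lemma graph_rel_sym: "(a, b) \<in> graph_rel T \<longleftrightarrow> (b, a) \<in> graph_rel T"
  unfolding graph_rel_def by (simp add: insert_commute[of a b] eq_commute[of a b])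

lemma cyclic_rel_mono: "r \<subseteq> s \<Longrightarrow> cyclic_rel r \<Longrightarrow> cyclic_rel s"
  unfolding cyclic_rel_def by (meson subsetD)

text \<open>The first vertex of a longest path is a leaf: another neighbour off the path would
  extend it, and one on the path would close a cycle.\<close>

lemma acyclic_graph_has_leaf:
  assumes fin: "finite T" and ne: "T \<noteq> {}" and card2: "\<And>e. e \<in> T \<Longrightarrow> card e = 2"
    and acyc: "\<not> cyclic_rel (graph_rel T)"
  obtains v w where "v \<noteq> w" "{v, w} \<in> T" "\<And>e. e \<in> T \<Longrightarrow> v \<in> e \<Longrightarrow> e = {v, w}"
proof -
  define path where "path vs \<longleftrightarrow> distinct vs \<and> length vs \<ge> 2 \<and>
    (\<forall>i. Suc i < length vs \<longrightarrow> (vs ! i, vs ! Suc i) \<in> graph_rel T)" for vs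
  have finV: "finite (\<Union>T)"
    using fin card2 by (auto intro!: finite_Union intro: card_ge_0_finite)
  have bound: "length vs \<le> card (\<Union>T)" if "path vs" for vs
  proof -
    have "x \<in> \<Union>T" if "x \<in> set vs" for x
    proof -
      from that obtain i where i: "i < length vs" "x = vs ! i" by (auto simp: in_set_conv_nth)
      show ?thesis
      proof (cases "Suc i < length vs")
        case True
        then have "(vs ! i, vs ! Suc i) \<in> graph_rel T" using \<open>path vs\<close> by (auto simp: path_def)
        then show ?thesis using i by (auto simp: graph_rel_def)
      next
        case False
        then have "i \<ge> 1" "Suc (i - 1) < length vs" "Suc (i - 1) = i"
          using i \<open>path vs\<close> by (auto simp: path_def)
        then have "(vs ! (i - 1), vs ! i) \<in> graph_rel T" using \<open>path vs\<close> by (metis path_def)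
        then show ?thesis using i by (auto simp: graph_rel_def)
      qed
    qed
    then have "card (set vs) \<le> card (\<Union>T)" using finV by (intro card_mono) auto
    then show ?thesis using that by (simp add: path_def distinct_card)
  qed
  obtain e where "e \<in> T" using ne by auto
  then obtain a b where ab: "e = {a, b}" "a \<noteq> b" using card2 by (meson card_2_iff)
  have "path [a, b]" using ab \<open>e \<in> T\<close> by (auto simp: path_def graph_rel_def)
  then have "\<exists>vs. path vs \<and> (\<forall>ws. path ws \<longrightarrow> length ws \<le> length vs)"
    by (rule ex_has_greatest_nat[where b = "Suc (card (\<Union>T))"]) (use bound le_imp_less_Suc in blast)
  then obtain vs where vs: "path vs" and max: "\<And>ws. path ws \<Longrightarrow> length ws \<le> length vs" by blast
  define v w where "v = vs ! 0" and "w = vs ! 1"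
  have len: "length vs \<ge> 2" and dist: "distinct vs" using vs by (auto simp: path_def)
  have vw: "(v, w) \<in> graph_rel T" using vs by (auto simp: path_def v_def w_def)
  have "e = {v, w}" if e: "e \<in> T" "v \<in> e" for e
  proof (rule ccontr)
    assume neq: "e \<noteq> {v, w}"
    obtain u where u: "e = {v, u}" "v \<noteq> u"
      using card2[OF e(1)] e(2) by (auto simp: card_2_iff)
    then have uv: "(u, v) \<in> graph_rel T" and uw: "u \<noteq> w"
      using e neq by (auto simp: graph_rel_def insert_commute)
    show False
    proof (cases "u \<in> set vs")
      case False
      have "path (u # vs)"
        using vs False uv by (auto simp: path_def nth_Cons v_def split: nat.split)
      then show False using max by force
    next
      case True
      then obtain j where j: "j < length vs" "u = vs ! j" by (auto simp: in_set_conv_nth)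
      \<comment> \<open>The neighbour is neither \<open>v\<close> (position 0) nor \<open>w\<close>
        (position 1), so the initial segment up to it has the three vertices that a cycle
        requires.\<close>
      have j2: "j \<ge> 2"
        using u uw j by (cases j; cases "j - 1") (auto simp: v_def w_def)
      let ?ws = "take (Suc j) vs"
      have len_ws: "length ?ws = Suc j" using j by simp
      have "(?ws ! i, ?ws ! ((i + 1) mod length ?ws)) \<in> graph_rel T" if "i < length ?ws" for i
      proof (cases "i = j")
        case True
        then show ?thesis using len_ws uv j by (simp add: v_def)
      next
        case False
        then have "Suc i < length vs" "i < j" using that len_ws j by auto
        then show ?thesis using len_ws vs by (simp add: path_def)
      qed
      then have "cyclic_rel (graph_rel T)"
        unfolding cyclic_rel_def using dist len_ws j2 by (intro exI[of _ ?ws]) auto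
      then show False using acyc by simp
    qed
  qed
  then show thesis using that[of v w] vw by (auto simp: graph_rel_def)
qed

section \<open>Collapsing a tree to a vertex\<close>

definition abs_collapse :: "'a set set \<Rightarrow> 'a set set \<Rightarrow> bool" where
  "abs_collapse C C' \<longleftrightarrow> (\<exists>\<sigma> \<tau>. \<sigma> \<in> C \<and> \<tau> \<in> C \<and> \<sigma> \<subset> \<tau> \<and> card \<tau> = Suc (card \<sigma>) \<and>
      (\<forall>\<rho>\<in>C. \<sigma> \<subset> \<rho> \<longrightarrow> \<rho> = \<tau>) \<and> C' = C - {\<sigma>, \<tau>})"

text \<open>The path is rerouted around the leaf: whenever it stands at \<open>w\<close>, the new
  path waits at the neighbour \<open>p\<close>. The second conjunct keeps track of this during the
  induction.\<close>

lemma rtrancl_remove_leaf: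
  assumes leaf: "\<And>e. e \<in> T \<Longrightarrow> w \<in> e \<Longrightarrow> e = {w, p}"
    and "(u, x) \<in> (graph_rel T)\<^sup>*" "u \<noteq> w"
  shows "(x \<noteq> w \<longrightarrow> (u, x) \<in> (graph_rel (T - {{w, p}}))\<^sup>*) \<and>
         (x = w \<longrightarrow> (u, p) \<in> (graph_rel (T - {{w, p}}))\<^sup>*)"
  using assms(2)
proof (induction rule: rtrancl_induct)
  case base
  then show ?case using assms(3) by simp
next
  case (step x y)
  show ?case
  proof (cases "x = w \<or> y = w")
    case True
    with step(2) have "{x, y} = {w, p}" "x \<noteq> y"
      using leaf[of "{x, y}"] by (auto simp: graph_rel_def)
    then show ?thesis using step(3) by (auto simp: doubleton_eq_iff)
  next
    case False
    then have "(x, y) \<in> graph_rel (T - {{w, p}})"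
      using step(2) by (auto simp: graph_rel_def doubleton_eq_iff)
    then show ?thesis using step(3) False by (auto intro: rtrancl_into_rtrancl)
  qed
qed

text \<open>A leaf is a free face of its only edge; collapsing this pair leaves a tree with one edge
  fewer.\<close>

lemma tree_collapses_to_vertex:
  assumes "finite T" "finite V" "V \<noteq> {}" and "\<And>e. e \<in> T \<Longrightarrow> card e = 2 \<and> e \<subseteq> V"
    and "\<And>u v. u \<in> V \<Longrightarrow> v \<in> V \<Longrightarrow> (u, v) \<in> (graph_rel T)\<^sup>*"
    and "\<not> cyclic_rel (graph_rel T)"
  shows "\<exists>v. abs_collapse\<^sup>*\<^sup>* ((\<lambda>v. {v}) ` V \<union> T) {{v}}"
  using assms
proof (induction T arbitrary: V rule: measure_induct_rule[where f = card])
  case (less T V)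
  show ?case
  proof (cases "T = {}")
    case True
    then have "graph_rel T = {}" by (auto simp: graph_rel_def)
    then have "u = v" if "u \<in> V" "v \<in> V" for u v using less.prems(5)[OF that] by simp
    then obtain v where "V = {v}" using less.prems(3) by (metis all_not_in_conv is_singletonI' is_singleton_def)
    then show ?thesis using True by auto
  next
    case False
    obtain w p where wp: "w \<noteq> p" "{w, p} \<in> T" and leaf: "\<And>e. e \<in> T \<Longrightarrow> w \<in> e \<Longrightarrow> e = {w, p}"
      by (rule acyclic_graph_has_leaf[OF less.prems(1) False _ less.prems(6)]) (use less.prems(4) in blast)+
    let ?T = "T - {{w, p}}" and ?V = "V - {w}"
    have "p \<in> ?V" "w \<in> V" using wp less.prems(4)[OF wp(2)] by auto
    have "\<exists>v. abs_collapse\<^sup>*\<^sup>* ((\<lambda>v. {v}) ` ?V \<union> ?T) {{v}}"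
    proof (rule less.IH)
      show "card ?T < card T" using wp less.prems(1) by (meson card_Diff1_less)
      show "?V \<noteq> {}" using \<open>p \<in> ?V\<close> by blast
      show "card e = 2 \<and> e \<subseteq> ?V" if "e \<in> ?T" for e using that less.prems(4) leaf by auto
      show "(u, v) \<in> (graph_rel ?T)\<^sup>*" if "u \<in> ?V" "v \<in> ?V" for u v
        using rtrancl_remove_leaf[OF leaf, where u = u and x = v] less.prems(5) that by auto
      show "\<not> cyclic_rel (graph_rel ?T)"
        using less.prems(6) cyclic_rel_mono[OF graph_rel_mono[of ?T T]] by auto
    qed (use less.prems in auto)
    moreover have "abs_collapse ((\<lambda>v. {v}) ` V \<union> T) ((\<lambda>v. {v}) ` ?V \<union> ?T)"
      unfolding abs_collapse_def
    proof (intro exI conjI)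
      show "{w} \<in> (\<lambda>v. {v}) ` V \<union> T" "{w, p} \<in> (\<lambda>v. {v}) ` V \<union> T" "{w} \<subset> {w, p}"
        "card {w, p} = Suc (card {w})" using wp \<open>w \<in> V\<close> by auto
      show "\<forall>\<rho>\<in>(\<lambda>v. {v}) ` V \<union> T. {w} \<subset> \<rho> \<longrightarrow> \<rho> = {w, p}" using leaf by auto
      have "{w} \<notin> T" using less.prems(4)[of "{w}"] by auto
      then show "(\<lambda>v. {v}) ` ?V \<union> ?T = (\<lambda>v. {v}) ` V \<union> T - {{w}, {w, p}}"
        using wp by auto
    qed
    ultimately show ?thesis by (meson converse_rtranclp_into_rtranclp)
  qed
qed

text \<open>Otherwise the support of \<open>c\<close> is a nonempty acyclic graph. At one of its
  leaves a single edge contributes to the boundary, which is then nonzero.\<close>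

lemma tree_has_no_cycles:
  assumes X: "finite X" "face_closed X" and T: "T \<subseteq> simplices X 2"
    and acyc: "\<not> cyclic_rel (graph_rel T)"
    and supp: "\<And>e. e \<in> simplices X 2 \<Longrightarrow> e \<notin> T \<Longrightarrow> c e = 0"
    and cyc: "\<And>\<sigma>. \<sigma> \<in> simplices X 1 \<Longrightarrow> bdry X c \<sigma> = 0"
    and e: "e \<in> simplices X 2"
  shows "c e = 0"
proof (rule ccontr)
  assume nz: "c e \<noteq> 0"
  define S where "S = {e \<in> T. c e \<noteq> 0}"
  have sub: "S \<subseteq> T" by (auto simp: S_def)
  have fin: "finite S" using X(1) T sub by (auto intro: finite_subset)
  have ne: "S \<noteq> {}" using e nz supp unfolding S_def by blast
  have acyc': "\<not> cyclic_rel (graph_rel S)"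
    using acyc cyclic_rel_mono[OF graph_rel_mono[OF sub]] by auto
  have card2: "card e = 2" if "e \<in> S" for e using that T sub by blast
  obtain v w where vw: "v \<noteq> w" "{v, w} \<in> S"
    and leaf: "\<And>e. e \<in> S \<Longrightarrow> v \<in> e \<Longrightarrow> e = {v, w}"
    using acyclic_graph_has_leaf[OF fin ne card2 acyc'] by metis
  have vwX: "{v, w} \<in> X" using vw T sub by blast
  then have "{v} \<in> X" using face_closedD(3)[OF X(2) vwX, of "{v}"] by auto
  have "bdry X c {v} = (\<Sum>e'\<in>cofaces X {v}. if e' = {v, w} then c e' else 0)"
    unfolding bdry_def
  proof (rule sum.cong[OF refl])
    fix e' assume "e' \<in> cofaces X {v}"
    then have "e' \<in> simplices X 2" "v \<in> e'" by (auto simp: cofaces_def)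
    moreover from this have "c e' = 0" if "e' \<noteq> {v, w}"
      using supp[of e'] leaf[of e'] that unfolding S_def by blast
    ultimately show "c e' = (if e' = {v, w} then c e' else 0)" by simp
  qed
  also have "\<dots> = c {v, w}"
  proof -
    have "{v, w} \<in> cofaces X {v}" using vw(1) vwX by (auto simp: cofaces_def)
    then show ?thesis using finite_cofaces[OF X(1), of "{v}"] by (simp add: sum.delta)
  qed
  finally show False using cyc[of "{v}"] \<open>{v} \<in> X\<close> vw by (auto simp: S_def)
qed

section \<open>Collapses and the closure computed by STT\<close>

text \<open>The edges that STT can determine in some order. Being a closure, it does not refer to
  the states of STT. An edge of \<open>f\<close> is named by the vertex opposite to it.\<close>

inductive_set known :: "'a set set \<Rightarrow> 'a set set \<Rightarrow> 'a set set" for X T where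
  tree: "e \<in> T \<Longrightarrow> e \<in> known X T"
| fill: "f \<in> simplices X 3 \<Longrightarrow> v \<in> f \<Longrightarrow> (\<And>w. w \<in> f \<Longrightarrow> w \<noteq> v \<Longrightarrow> f - {w} \<in> known X T)
    \<Longrightarrow> f - {v} \<in> known X T"

lemma known_mono:
  assumes "X \<subseteq> Y" "e \<in> known X T"
  shows "e \<in> known Y T"
  using assms(2)
proof induction
  case (fill f v)
  have "f \<in> simplices Y 3" using fill.hyps(1) assms(1) by blast
  then show ?case using known.fill[OF _ fill.hyps(2) fill.IH] by blast
qed (rule known.tree)

section \<open>From a collapse to a spanning tree\<close>

definition abs_tree :: "'a set set \<Rightarrow> 'a set set \<Rightarrow> bool" where
  "abs_tree X T \<longleftrightarrow> T \<subseteq> simplices X 2 \<and>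
     (\<forall>u v. {u} \<in> X \<longrightarrow> {v} \<in> X \<longrightarrow> (u, v) \<in> (graph_rel T)\<^sup>*) \<and> \<not> cyclic_rel (graph_rel T)"

lemma abs_tree_superset:
  assumes "abs_tree C' T" "C' \<subseteq> C" "\<And>u. {u} \<in> C \<Longrightarrow> {u} \<in> C'"
  shows "abs_tree C T"
proof -
  have "T \<subseteq> simplices C 2" using assms(1,2) unfolding abs_tree_def by blast
  then show ?thesis using assms(1,3) unfolding abs_tree_def by presburger
qed

text \<open>No surviving cell contains a removed one: every cell that properly contains
  \<open>\<sigma>\<close> or \<open>\<tau>\<close> also properly contains \<open>\<sigma>\<close>,
  hence is \<open>\<tau>\<close>.\<close>

lemma abs_collapse_face_closed:
  assumes "abs_collapse C C'" "face_closed C"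
  shows "face_closed C'"
proof -
  obtain \<sigma> \<tau> where C': "C' = C - {\<sigma>, \<tau>}" and st: "\<sigma> \<in> C" "\<sigma> \<subset> \<tau>"
    and free: "\<forall>\<rho>\<in>C. \<sigma> \<subset> \<rho> \<longrightarrow> \<rho> = \<tau>"
    using assms(1) unfolding abs_collapse_def by blast
  show ?thesis unfolding face_closed_def
  proof (intro ballI conjI allI impI)
    fix S assume S: "S \<in> C'"
    then show "finite S" "S \<noteq> {}" using assms(2) C' by (auto dest: face_closedD)
    fix R assume R: "R \<subseteq> S" "R \<noteq> {}"
    then have "R \<in> C" using S C' assms(2) by (auto dest: face_closedD)
    moreover have "R \<noteq> \<sigma>" "R \<noteq> \<tau>" using R S C' st free by blast+
    ultimately show "R \<in> C'" using C' by auto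
  qed
qed

lemma cyclic_rel_remove_leaf:
  assumes cyc: "cyclic_rel (graph_rel T)" and leaf: "\<And>e. e \<in> T \<Longrightarrow> w \<in> e \<Longrightarrow> e = {w, p}"
  shows "cyclic_rel (graph_rel (T - {{w, p}}))"
proof -
  obtain vs where vs: "distinct vs" "length vs \<ge> 3"
    and step: "\<And>i. i < length vs \<Longrightarrow> (vs ! i, vs ! ((i + 1) mod length vs)) \<in> graph_rel T"
    using cyc unfolding cyclic_rel_def by auto
  let ?n = "length vs"
  have edge: "y = p" if "(w, y) \<in> graph_rel T" for y
    using leaf[of "{w, y}"] that by (auto simp: graph_rel_def doubleton_eq_iff)
  have notin: "w \<noteq> vs ! i" if i: "i < ?n" for i
  proof
    assume w: "w = vs ! i"
    define j where "j = (i + 1) mod ?n"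
    define k where "k = (if i = 0 then ?n - 1 else i - 1)"
    have kn: "k < ?n" and ki: "(k + 1) mod ?n = i" using i vs(2) by (auto simp: k_def)
    have jn: "j < ?n" unfolding j_def using vs(2) by (intro mod_less_divisor) auto
    \<comment> \<open>Successor and predecessor on the cycle differ because its length is at least
      three.\<close>
    have jk: "j \<noteq> k" using i vs(2) by (auto simp: j_def k_def mod_if)
    have "vs ! j = p" using edge step[OF i] w by (auto simp: j_def)
    moreover have "vs ! k = p" using edge step[OF kn] w ki graph_rel_sym by metis
    ultimately show False using jk jn kn vs(1) by (metis nth_eq_iff_index_eq)
  qed
  have "(vs ! i, vs ! ((i + 1) mod ?n)) \<in> graph_rel (T - {{w, p}})" if i: "i < ?n" for i
  proof -
    have "(i + 1) mod ?n < ?n" using vs(2) by (intro mod_less_divisor) auto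
    then show ?thesis using step[OF i] notin[OF i] notin[of "(i + 1) mod ?n"]
      by (auto simp: graph_rel_def doubleton_eq_iff)
  qed
  then show ?thesis unfolding cyclic_rel_def using vs by blast
qed

text \<open>The collapse is undone step by step. A vertex-edge pair attaches a leaf to the tree, an
  edge-triangle pair makes the edge computable from the triangle, and a triangle-tetrahedron pair
  changes neither vertices nor edges.\<close>

lemma collapsible_imp_tree:
  assumes "abs_collapse\<^sup>*\<^sup>* C {{v}}" "face_closed C"
  shows "\<exists>T. abs_tree C T \<and> simplices C 2 \<subseteq> known C T"
  using assms
proof (induction rule: converse_rtranclp_induct)
  case base
  have "\<not> cyclic_rel ({} :: ('b \<times> 'b) set)"
    unfolding cyclic_rel_def by (metis One_nat_def Suc_le_eq empty_iff le_trans le_add2 numeral_3_eq_3 plus_1_eq_Suc)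
  then have "abs_tree {{v}} {}" by (auto simp: abs_tree_def graph_rel_def)
  moreover have "simplices {{v}} 2 = {}" by auto
  ultimately show ?case by fastforce
next
  case (step C C')
  have fc: "face_closed C" and fc': "face_closed C'"
    using step.prems abs_collapse_face_closed[OF step.hyps(1)] by auto
  obtain T where T: "abs_tree C' T" "simplices C' 2 \<subseteq> known C' T" using step.IH[OF fc'] by blast
  obtain \<sigma> \<tau> where C': "C' = C - {\<sigma>, \<tau>}" and st: "\<sigma> \<in> C" "\<tau> \<in> C" "\<sigma> \<subset> \<tau>" "card \<tau> = Suc (card \<sigma>)"
    and free: "\<forall>\<rho>\<in>C. \<sigma> \<subset> \<rho> \<longrightarrow> \<rho> = \<tau>"
    using step.hyps(1) unfolding abs_collapse_def by blast
  have fin: "finite \<sigma>" "\<sigma> \<noteq> {}" "finite \<tau>" using st fc by (auto dest: face_closedD)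
  have sub: "C' \<subseteq> C" using C' by auto
  have known_sub: "simplices C' 2 \<subseteq> known C T" using T(2) known_mono[OF sub] by blast
  consider "card \<sigma> = 1" | "card \<sigma> = 2" | "card \<sigma> \<ge> 3"
    using fin card_gt_0_iff[of \<sigma>] by linarith
  then show ?case
  proof cases
    case 1
    then obtain w where w: "\<sigma> = {w}" by (auto simp: card_1_singleton_iff)
    have "card \<tau> = 2" using st(4) 1 by simp
    then obtain p where p: "\<tau> = {w, p}" "w \<noteq> p" using st(3) w by (auto simp: card_2_iff)
    have T2: "T \<subseteq> simplices C' 2" using T(1) by (simp add: abs_tree_def)
    have leaf: "e = {w, p}" if "e \<in> insert \<tau> T" "w \<in> e" for e
    proof -
      have "e \<in> C" "card e = 2" using that T2 sub st \<open>card \<tau> = 2\<close> by auto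
      then have "\<sigma> \<subset> e" using w that by auto
      then show ?thesis using free \<open>e \<in> C\<close> p by blast
    qed
    have \<tau>T: "\<tau> \<notin> T" using T2 C' by auto
    have pC: "{p} \<in> C'" using face_closedD(3)[OF fc st(2), of "{p}"] p w C' by auto
    have "abs_tree C (insert \<tau> T)"
      unfolding abs_tree_def
    proof (intro conjI allI impI)
      show "insert \<tau> T \<subseteq> simplices C 2" using T2 sub st \<open>card \<tau> = 2\<close> by auto
      show "\<not> cyclic_rel (graph_rel (insert \<tau> T))"
      proof
        assume "cyclic_rel (graph_rel (insert \<tau> T))"
        then have "cyclic_rel (graph_rel (insert \<tau> T - {{w, p}}))"
          using leaf by (rule cyclic_rel_remove_leaf)
        moreover have "insert \<tau> T - {{w, p}} = T" using \<tau>T p by auto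
        ultimately show False using T(1) by (simp add: abs_tree_def)
      qed
      have wp: "(w, p) \<in> graph_rel (insert \<tau> T)" "(p, w) \<in> graph_rel (insert \<tau> T)"
        using p by (auto simp: graph_rel_def insert_commute)
      have path: "(x, y) \<in> (graph_rel (insert \<tau> T))\<^sup>*" if "{x} \<in> C'" "{y} \<in> C'" for x y
        using T(1) that rtrancl_mono[OF graph_rel_mono[OF subset_insertI[of T \<tau>]]]
        unfolding abs_tree_def by blast
      have to_p: "(x, p) \<in> (graph_rel (insert \<tau> T))\<^sup>* \<and> (p, x) \<in> (graph_rel (insert \<tau> T))\<^sup>*"
        if "{x} \<in> C" for x
      proof (cases "x = w")
        case False
        then have "{x} \<in> C'" using that C' p w by auto
        then show ?thesis using path pC by blast
      qed (use wp in auto)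
      show "(x, y) \<in> (graph_rel (insert \<tau> T))\<^sup>*" if "{x} \<in> C" "{y} \<in> C" for x y
        using to_p that by (meson rtrancl_trans)
    qed
    moreover have "simplices C 2 \<subseteq> known C (insert \<tau> T)"
    proof
      fix e assume e: "e \<in> simplices C 2"
      show "e \<in> known C (insert \<tau> T)"
      proof (cases "e = \<tau>")
        case False
        then have "e \<in> simplices C' 2" using e C' 1 by auto
        then have "e \<in> known C T" using known_sub by blast
        then show ?thesis
        proof induction
          case (fill f v)
          show ?case by (rule known.fill[OF fill.hyps(1,2) fill.IH])
        qed (auto intro: known.tree)
      qed (auto intro: known.tree)
    qed
    ultimately show ?thesis by blast
  next
    case 2
    have "{u} \<in> C'" if "{u} \<in> C" for u using that C' 2 st(4) by auto
    then have "abs_tree C T" by (rule abs_tree_superset[OF T(1) sub])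
    moreover have "simplices C 2 \<subseteq> known C T"
    proof
      fix e assume e: "e \<in> simplices C 2"
      show "e \<in> known C T"
      proof (cases "e = \<sigma>")
        case False
        then have "e \<in> simplices C' 2" using e C' 2 st(4) by auto
        then show ?thesis using known_sub by blast
      next
        case True
        have "\<sigma> \<in> {\<sigma>. \<sigma> \<subset> \<tau> \<and> card \<tau> = Suc (card \<sigma>)}" using st(3,4) by simp
        then obtain x where x: "x \<in> \<tau>" "\<sigma> = \<tau> - {x}"
          unfolding facets_eq_image[OF fin(3)] by blast
        \<comment> \<open>The other two edges of the triangle survive this step, so they are known
          already and \<open>fill\<close> yields the free edge.\<close>
        have others: "\<tau> - {y} \<in> known C T" if y: "y \<in> \<tau>" "y \<noteq> x" for y
        proof -
          have c: "card (\<tau> - {y}) = 2" using st(4) 2 y fin by auto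
          then have "\<tau> - {y} \<noteq> {}" by (metis card.empty zero_neq_numeral)
          then have "\<tau> - {y} \<in> C" using face_closedD(3)[OF fc st(2), of "\<tau> - {y}"] by auto
          moreover have "\<tau> - {y} \<noteq> \<sigma>" "\<tau> - {y} \<noteq> \<tau>" using x y by auto
          ultimately have "\<tau> - {y} \<in> simplices C' 2" using C' c by blast
          then show "\<tau> - {y} \<in> known C T" using known_sub by blast
        qed
        have "\<tau> \<in> simplices C 3" using st 2 by auto
        then show ?thesis using known.fill[OF _ x(1) others] True x(2) by blast
      qed
    qed
    ultimately show ?thesis by blast
  next
    case 3
    have "{u} \<in> C'" if "{u} \<in> C" for u using that C' 3 st(4) by auto
    then have "abs_tree C T" by (rule abs_tree_superset[OF T(1) sub])
    moreover have "simplices C 2 \<subseteq> simplices C' 2" using 3 st(4) C' by auto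
    ultimately show ?thesis using known_sub by blast
  qed
qed

text \<open>The triangles that first determine an edge are recorded in \<open>F\<close>. They form an acyclic
  matching with the edges outside \<open>T\<close>, and every edge of \<open>S\<close> is homologous in \<open>F\<close> to a chain
  of \<open>T\<close>.\<close>

definition stt_filling :: "'a set set \<Rightarrow> 'a set set \<Rightarrow> 'a set set \<Rightarrow> 'a set set \<Rightarrow> bool" where
  "stt_filling X T S F \<longleftrightarrow> T \<subseteq> S \<and> S \<subseteq> simplices X 2 \<and> F \<subseteq> simplices X 3 \<and>
     (\<forall>f\<in>F. \<forall>v\<in>f. f - {v} \<in> S) \<and>
     abs_collapse\<^sup>*\<^sup>* (simplices X 1 \<union> S \<union> F) (simplices X 1 \<union> T) \<and>
     (\<forall>z. (\<forall>f\<in>simplices X 3 - F. z f = 0) \<longrightarrow> (\<forall>e\<in>S. bdry X z e = 0) \<longrightarrow> (\<forall>f\<in>F. z f = 0)) \<and>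
     (\<forall>e\<in>S. \<exists>z. (\<forall>f. f \<notin> F \<longrightarrow> z f = 0) \<and>
        (\<forall>e'\<in>simplices X 2 - T. bdry X z e' = of_bool (e' = e)))"

lemma stt_fillingD:
  assumes "stt_filling X T S F"
  shows "T \<subseteq> S" "S \<subseteq> simplices X 2" "F \<subseteq> simplices X 3"
    "\<And>f v. f \<in> F \<Longrightarrow> v \<in> f \<Longrightarrow> f - {v} \<in> S"
    "abs_collapse\<^sup>*\<^sup>* (simplices X 1 \<union> S \<union> F) (simplices X 1 \<union> T)"
    "\<And>z f. (\<And>f. f \<in> simplices X 3 - F \<Longrightarrow> z f = 0) \<Longrightarrow> (\<And>e. e \<in> S \<Longrightarrow> bdry X z e = 0) \<Longrightarrow> f \<in> F \<Longrightarrow> z f = 0"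
    "\<And>e. e \<in> S \<Longrightarrow> \<exists>z. (\<forall>f. f \<notin> F \<longrightarrow> z f = 0) \<and>
        (\<forall>e'\<in>simplices X 2 - T. bdry X z e' = of_bool (e' = e))"
proof -
  note a = assms[unfolded stt_filling_def]
  show "T \<subseteq> S" using a by (elim conjE)
  show "S \<subseteq> simplices X 2" using a by (elim conjE)
  show "F \<subseteq> simplices X 3" using a by (elim conjE)
  show "abs_collapse\<^sup>*\<^sup>* (simplices X 1 \<union> S \<union> F) (simplices X 1 \<union> T)"
    using a by (elim conjE)
  have "\<forall>f\<in>F. \<forall>v\<in>f. f - {v} \<in> S" using a by (elim conjE)
  then show "\<And>f v. f \<in> F \<Longrightarrow> v \<in> f \<Longrightarrow> f - {v} \<in> S" by blast
  have "\<forall>z. (\<forall>f\<in>simplices X 3 - F. z f = 0) \<longrightarrow> (\<forall>e\<in>S. bdry X z e = 0) \<longrightarrow> (\<forall>f\<in>F. z f = 0)"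
    using a by (elim conjE)
  then show "\<And>z f. (\<And>f. f \<in> simplices X 3 - F \<Longrightarrow> z f = 0) \<Longrightarrow> (\<And>e. e \<in> S \<Longrightarrow> bdry X z e = 0) \<Longrightarrow> f \<in> F \<Longrightarrow> z f = 0"
    by blast
  have "\<forall>e\<in>S. \<exists>z. (\<forall>f. f \<notin> F \<longrightarrow> z f = 0) \<and>
        (\<forall>e'\<in>simplices X 2 - T. bdry X z e' = of_bool (e' = e))" using a by (elim conjE)
  then show "\<And>e. e \<in> S \<Longrightarrow> \<exists>z. (\<forall>f. f \<notin> F \<longrightarrow> z f = 0) \<and>
        (\<forall>e'\<in>simplices X 2 - T. bdry X z e' = of_bool (e' = e))" by (rule bspec)
qed

text \<open>Triangles of \<open>F\<close> have all their edges in \<open>S\<close>, so within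
  \<open>insert f F\<close> the new edge belongs to \<open>f\<close> alone. Hence it is a free face,
  and the coefficient of \<open>f\<close> vanishes in every 2-cycle carried by the enlarged
  set.\<close>

lemma stt_filling_step:
  assumes X: "finite X" "face_closed X" and fil: "stt_filling X T S F"
    and f: "f \<in> simplices X 3" "v \<in> f" "\<And>w. w \<in> f \<Longrightarrow> w \<noteq> v \<Longrightarrow> f - {w} \<in> S" and new: "f - {v} \<notin> S"
  shows "stt_filling X T (insert (f - {v}) S) (insert f F)"
proof -
  let ?e = "f - {v}"
  note fil = stt_fillingD[OF fil]
  have finf: "finite f" "card f = 3" "f \<in> X" using f X(2) by (auto dest: face_closedD)
  have ce: "card ?e = 2" using finf f(2) by simp
  then have "?e \<noteq> {}" by (metis card.empty zero_neq_numeral)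
  then have eX: "?e \<in> X" using face_closedD(3)[OF X(2) finf(3), of ?e] by auto
  have fF: "f \<notin> F" using fil(4) f(2) new by blast
  have coface: "g = f" if gF: "g \<in> insert f F" and eg: "?e \<subset> g" for g
  proof (rule ccontr)
    assume "g \<noteq> f"
    then have g: "g \<in> F" "g \<in> X" "card g = 3" using gF fil(3) by auto
    then have fing: "finite g" using X(2) by (auto dest: face_closedD)
    have "?e \<in> {\<sigma>. \<sigma> \<subset> g \<and> card g = Suc (card \<sigma>)}" using eg g ce by simp
    then obtain u where "u \<in> g" "?e = g - {u}"
      unfolding facets_eq_image[OF fing] by blast
    then show False using fil(4) g new by auto
  qed
  have "abs_collapse (simplices X 1 \<union> insert ?e S \<union> insert f F) (simplices X 1 \<union> S \<union> F)"
    unfolding abs_collapse_def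
  proof (intro exI conjI)
    show "?e \<in> simplices X 1 \<union> insert ?e S \<union> insert f F"
      "f \<in> simplices X 1 \<union> insert ?e S \<union> insert f F" "?e \<subset> f" using f(2) by auto
    show "card f = Suc (card ?e)" using ce finf by simp
    show "\<forall>\<rho>\<in>simplices X 1 \<union> insert ?e S \<union> insert f F. ?e \<subset> \<rho> \<longrightarrow> \<rho> = f"
    proof (intro ballI impI)
      fix \<rho> assume \<rho>: "\<rho> \<in> simplices X 1 \<union> insert ?e S \<union> insert f F" "?e \<subset> \<rho>"
      have "card \<rho> > 2"
      proof -
        have "\<rho> \<in> X" using \<rho>(1) fil(2,3) finf eX by auto
        then show ?thesis using \<rho>(2) ce X(2) by (metis face_closedD(1) psubset_card_mono)
      qed
      then have "\<rho> \<in> insert f F" using \<rho>(1) fil(2) ce by auto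
      then show "\<rho> = f" using coface \<rho>(2) by blast
    qed
    show "simplices X 1 \<union> S \<union> F = simplices X 1 \<union> insert ?e S \<union> insert f F - {?e, f}"
      using new fF ce finf fil(2,3) by auto
  qed
  then have coll: "abs_collapse\<^sup>*\<^sup>* (simplices X 1 \<union> insert ?e S \<union> insert f F) (simplices X 1 \<union> T)"
    using fil(5) by (rule converse_rtranclp_into_rtranclp)
  have cyc: "\<forall>g\<in>insert f F. z g = 0"
    if z: "\<forall>g\<in>simplices X 3 - insert f F. z g = 0" "\<forall>e\<in>insert ?e S. bdry X z e = 0" for z
  proof -
    have "bdry X z ?e = (\<Sum>g\<in>cofaces X ?e. if g = f then z g else 0)"
      unfolding bdry_def
    proof (rule sum.cong[OF refl])
      fix g assume g: "g \<in> cofaces X ?e"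
      then have "z g = 0" if "g \<noteq> f" using z(1) coface[of g] ce that by (auto simp: cofaces_def)
      then show "z g = (if g = f then z g else 0)" by auto
    qed
    also have "\<dots> = z f"
    proof -
      have "f \<in> cofaces X ?e" unfolding cofaces_def using f(2) ce finf by auto
      then show ?thesis using finite_cofaces[OF X(1), of ?e] by (simp add: sum.delta)
    qed
    finally have "z f = 0" using z by auto
    moreover have "z g = 0" if "g \<in> F" for g
      using _ _ that
    proof (rule fil(6))
      show "z g = 0" if "g \<in> simplices X 3 - F" for g using z(1) that \<open>z f = 0\<close> by auto
      show "bdry X z e = 0" if "e \<in> S" for e using z(2) that by auto
    qed
    ultimately show ?thesis by auto
  qed
  have chain: "\<exists>z. (\<forall>g. g \<notin> insert f F \<longrightarrow> z g = 0) \<and>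
      (\<forall>e'\<in>simplices X 2 - T. bdry X z e' = of_bool (e' = e))" if e: "e \<in> insert ?e S" for e
  proof (cases "e \<in> S")
    case True
    then obtain z where "\<forall>f. f \<notin> F \<longrightarrow> z f = 0"
      "\<forall>e'\<in>simplices X 2 - T. bdry X z e' = of_bool (e' = e)" using fil(7) by blast
    then show ?thesis by (intro exI[of _ z]) auto
  next
    case False
    then have ee: "e = ?e" using e by simp
    obtain a b where ab: "?e = {a, b}" "a \<noteq> b" using ce by (auto simp: card_2_iff)
    then have fab: "f = {v, a, b}" "v \<noteq> a" "v \<noteq> b" using f(2) by auto
    have S: "f - {a} \<in> S" "f - {b} \<in> S" using f(3) fab by auto
    obtain za zb where za: "\<forall>f. f \<notin> F \<longrightarrow> za f = 0"
        "\<forall>e'\<in>simplices X 2 - T. bdry X za e' = of_bool (e' = f - {a})"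
      and zb: "\<forall>f. f \<notin> F \<longrightarrow> zb f = 0"
        "\<forall>e'\<in>simplices X 2 - T. bdry X zb e' = of_bool (e' = f - {b})" using fil(7)[OF S(1)] fil(7)[OF S(2)] by blast
    \<comment> \<open>Off \<open>T\<close>, the boundaries of \<open>za\<close> and
      \<open>zb\<close> are the two old edges of \<open>f\<close> (or nothing, if these are in
      \<open>T\<close>). Adding both to \<open>f\<close> cancels those edges and leaves the new
      one.\<close>
    let ?z = "\<lambda>g. of_bool (g = f) + (za g + zb g)"
    have "bdry X ?z e' = of_bool (e' = e)" if e': "e' \<in> simplices X 2 - T" for e'
    proof -
      have "bdry X ?z e' = of_bool (e' \<subset> f \<and> card f = Suc (card e')) + (of_bool (e' = f - {a}) + of_bool (e' = f - {b}))"
        using e' za zb by (simp add: bdry_add bdry_single[OF X(1) finf(3)])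
      also have "\<dots> = of_bool (e' = e)"
      proof (cases "e' \<subset> f \<and> card f = Suc (card e')")
        case True
        then have "e' \<in> (\<lambda>v. f - {v}) ` f" using facets_eq_image[OF finf(1)] by blast
        then consider "e' = f - {v}" | "e' = f - {a}" | "e' = f - {b}" using fab by auto
        moreover have "f - {v} \<noteq> f - {a}" "f - {v} \<noteq> f - {b}" "f - {a} \<noteq> f - {b}"
          using fab ab by auto
        ultimately show ?thesis using True ee by cases auto
      next
        case False
        moreover have "f - {x} \<subset> f \<and> card f = Suc (card (f - {x}))" if "x \<in> f" for x
          using facets_eq_image[OF finf(1)] that by blast
        ultimately have "e' \<noteq> f - {v}" "e' \<noteq> f - {a}" "e' \<noteq> f - {b}" using fab by blast+
        then show ?thesis using False ee by auto
      qed
      finally show ?thesis .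
    qed
    moreover have "\<forall>g. g \<notin> insert f F \<longrightarrow> ?z g = 0" using za zb by auto
    ultimately show ?thesis by (intro exI[of _ ?z]) auto
  qed
  have faces: "\<forall>g\<in>insert f F. \<forall>u\<in>g. g - {u} \<in> insert ?e S"
    using f(3) fil(4) by auto
  have "T \<subseteq> insert ?e S" "insert ?e S \<subseteq> simplices X 2" "insert f F \<subseteq> simplices X 3"
    using fil(1,2,3) eX ce f(1) by auto
  moreover have "\<forall>z. (\<forall>g\<in>simplices X 3 - insert f F. z g = 0) \<longrightarrow>
      (\<forall>e\<in>insert ?e S. bdry X z e = 0) \<longrightarrow> (\<forall>g\<in>insert f F. z g = 0)"
    using cyc by (intro allI impI)
  moreover have "\<forall>e\<in>insert ?e S. \<exists>z. (\<forall>g. g \<notin> insert f F \<longrightarrow> z g = 0) \<and>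
      (\<forall>e'\<in>simplices X 2 - T. bdry X z e' = of_bool (e' = e))"
    using chain by (rule ballI)
  ultimately show ?thesis
    unfolding stt_filling_def using coll faces by (intro conjI)
qed

text \<open>Starting from \<open>S = T\<close> and \<open>F = {}\<close>, triangles are added while
  possible. Once none fits, \<open>S\<close> is closed under the rules of \<open>known\<close> and
  so contains every edge.\<close>

lemma stt_filling_exists:
  assumes X: "finite X" "face_closed X" and T: "T \<subseteq> simplices X 2"
    and all: "simplices X 2 \<subseteq> known X T"
  shows "\<exists>F. stt_filling X T (simplices X 2) F"
proof -
  have base: "stt_filling X T T {}"
    unfolding stt_filling_def using T by (auto intro!: exI[of _ "\<lambda>_. 0"] simp: bdry_zero)
  have "\<exists>F. stt_filling X T (simplices X 2) F" if "stt_filling X T S F" for S F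
    using that
  proof (induction "card (simplices X 2 - S)" arbitrary: S F rule: less_induct)
    case less
    note fil = stt_fillingD[OF less.prems]
    show ?case
    proof (cases "S = simplices X 2")
      case True
      then show ?thesis using less.prems by blast
    next
      case False
      have "\<exists>f v. f \<in> simplices X 3 \<and> v \<in> f \<and> (\<forall>w\<in>f. w \<noteq> v \<longrightarrow> f - {w} \<in> S) \<and> f - {v} \<notin> S"
      proof (rule ccontr)
        assume no: "\<not> ?thesis"
        have "e \<in> S" if "e \<in> known X T" for e
          using that
        proof induction
          case (tree e)
          then show ?case using fil(1) by blast
        next
          case (fill f v)
          then show ?case using no by blast
        qed
        then show False using all False fil(2) by blast
      qed
      then obtain f v where f: "f \<in> simplices X 3" "v \<in> f" "\<And>w. w \<in> f \<Longrightarrow> w \<noteq> v \<Longrightarrow> f - {w} \<in> S"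
        "f - {v} \<notin> S" by blast
      have step: "stt_filling X T (insert (f - {v}) S) (insert f F)"
        by (rule stt_filling_step[OF X less.prems f])
      then have "f - {v} \<in> simplices X 2" using stt_fillingD(2)[OF step] by blast
      then have "card (simplices X 2 - insert (f - {v}) S) < card (simplices X 2 - S)"
        using X(1) f(4) by (intro psubset_card_mono) auto
      then show ?thesis using less.hyps step by blast
    qed
  qed
  then show ?thesis using base by blast
qed

section \<open>Collapsing the tetrahedra onto the filling triangles\<close>

text \<open>The geometry of the ball enters through \<open>no_3_cycle\<close>,
  \<open>fill_2_cycle\<close> and \<open>manifold\<close>; with these given, the argument is purely
  combinatorial.\<close>

lemma tree_imp_collapsible:
  assumes X: "finite X" "face_closed X" "\<And>\<sigma>. \<sigma> \<in> X \<Longrightarrow> card \<sigma> \<le> 4" "X \<noteq> {}"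
    and no_3_cycle: "\<And>a t. (\<And>f. f \<in> simplices X 3 \<Longrightarrow> bdry X a f = 0) \<Longrightarrow> t \<in> simplices X 4 \<Longrightarrow> a t = 0"
    and fill_2_cycle: "\<And>z. (\<And>e. e \<in> simplices X 2 \<Longrightarrow> bdry X z e = 0) \<Longrightarrow>
          \<exists>a. \<forall>f\<in>simplices X 3. bdry X a f = z f"
    and manifold: "\<And>f. f \<in> simplices X 3 \<Longrightarrow> card (cofaces X f) \<le> 2"
    and tree: "abs_tree X T" and all: "simplices X 2 \<subseteq> known X T"
  shows "\<exists>v. abs_collapse\<^sup>*\<^sup>* X {{v}}"
proof -
  have T2: "T \<subseteq> simplices X 2" using tree by (simp add: abs_tree_def)
  obtain F where fil: "stt_filling X T (simplices X 2) F"
    using stt_filling_exists[OF X(1,2) T2 all] by blast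
  note fil = stt_fillingD[OF fil]
  let ?Y = "\<lambda>G D. simplices X 1 \<union> simplices X 2 \<union> G \<union> D"
  \<comment> \<open>\<open>G\<close> and \<open>D\<close> are the triangles and tetrahedra still
    present. The last clause encodes the order of the collapse: apart from its partner, a removed
    triangle lies only in tetrahedra removed earlier, so vanishing of the boundary on removed
    triangles propagates to all removed tetrahedra.\<close>
  define inv where "inv G D \<longleftrightarrow> F \<subseteq> G \<and> G \<subseteq> simplices X 3 \<and> D \<subseteq> simplices X 4 \<and>
     (\<forall>t\<in>D. \<forall>f\<in>simplices X 3. f \<subset> t \<longrightarrow> f \<in> G) \<and> abs_collapse\<^sup>*\<^sup>* X (?Y G D) \<and>
     (\<forall>a. (\<forall>f\<in>simplices X 3 - G. bdry X a f = 0) \<longrightarrow> (\<forall>t\<in>simplices X 4 - D. a t = 0))" for G D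
  have "X \<subseteq> ?Y (simplices X 3) (simplices X 4)"
  proof
    fix \<sigma> assume \<sigma>: "\<sigma> \<in> X"
    then have "card \<sigma> > 0" using X(2) by (simp add: card_gt_0_iff face_closedD)
    then have "card \<sigma> \<in> {1, 2, 3, 4}" using X(3)[OF \<sigma>] by auto
    then show "\<sigma> \<in> ?Y (simplices X 3) (simplices X 4)" using \<sigma> by auto
  qed
  then have "?Y (simplices X 3) (simplices X 4) = X" by auto
  then have start: "inv (simplices X 3) (simplices X 4)" unfolding inv_def using fil(3) by auto
  have invD: "F \<subseteq> G" "G \<subseteq> simplices X 3" "D \<subseteq> simplices X 4"
      "\<And>t f. t \<in> D \<Longrightarrow> f \<in> simplices X 3 \<Longrightarrow> f \<subset> t \<Longrightarrow> f \<in> G" "abs_collapse\<^sup>*\<^sup>* X (?Y G D)"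
      "\<And>a t. (\<And>f. f \<in> simplices X 3 - G \<Longrightarrow> bdry X a f = 0) \<Longrightarrow> t \<in> simplices X 4 - D \<Longrightarrow> a t = 0"
    if "inv G D" for G D
  proof -
    note a = that[unfolded inv_def]
    show "F \<subseteq> G" using a by (elim conjE)
    show "G \<subseteq> simplices X 3" using a by (elim conjE)
    show "D \<subseteq> simplices X 4" using a by (elim conjE)
    show "abs_collapse\<^sup>*\<^sup>* X (?Y G D)" using a by (elim conjE)
    have "\<forall>t\<in>D. \<forall>f\<in>simplices X 3. f \<subset> t \<longrightarrow> f \<in> G" using a by (elim conjE)
    then show "\<And>t f. t \<in> D \<Longrightarrow> f \<in> simplices X 3 \<Longrightarrow> f \<subset> t \<Longrightarrow> f \<in> G" by blast
    have "\<forall>a. (\<forall>f\<in>simplices X 3 - G. bdry X a f = 0) \<longrightarrow> (\<forall>t\<in>simplices X 4 - D. a t = 0)"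
      using a by (elim conjE)
    then show "\<And>a t. (\<And>f. f \<in> simplices X 3 - G \<Longrightarrow> bdry X a f = 0) \<Longrightarrow> t \<in> simplices X 4 - D \<Longrightarrow> a t = 0"
      by blast
  qed
  have "\<exists>G. inv G {}" if "inv G D" for G D
    using that
  proof (induction "card D" arbitrary: G D rule: less_induct)
    case less
    note inv' = invD[OF less.prems]
    show ?case
    proof (cases "D = {}")
      case True
      then show ?thesis using less.prems by blast
    next
      case False
      let ?a = "\<lambda>t. of_bool (t \<in> D) :: bit"
      \<comment> \<open>Otherwise the boundary of \<open>D\<close> is a 2-cycle carried by
        \<open>F\<close>, hence zero, and \<open>D\<close> is a nonzero 3-cycle.\<close>
      have "\<exists>f\<in>simplices X 3 - F. bdry X ?a f \<noteq> 0"
      proof (rule ccontr)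
        assume "\<not> ?thesis"
        then have off: "bdry X ?a f = 0" if "f \<in> simplices X 3 - F" for f using that by blast
        have "bdry X ?a f = 0" if "f \<in> F" for f
          by (rule fil(6)[where z = "bdry X ?a"]) (use off that bdry_bdry[OF X(1,2)] in auto)
        then have "bdry X ?a f = 0" if "f \<in> simplices X 3" for f using off that by blast
        then have "?a t = 0" if "t \<in> simplices X 4" for t using no_3_cycle that by blast
        then show False using False inv'(3) by force
      qed
      then obtain f where f: "f \<in> simplices X 3" "f \<notin> F" "bdry X ?a f \<noteq> 0" by blast
      have "bdry X ?a f = of_nat (card (cofaces X f \<inter> D))"
        unfolding bdry_def using finite_cofaces[OF X(1)] by (simp add: of_bool_def sum.If_cases)
      moreover have "card (cofaces X f \<inter> D) \<le> 2"
        using manifold[OF f(1)] card_mono[OF finite_cofaces[OF X(1), of f], of "cofaces X f \<inter> D"] by auto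
      \<comment> \<open>An odd number that is at most two.\<close>
      ultimately have "card (cofaces X f \<inter> D) = 1"
        using f(3) by (cases "card (cofaces X f \<inter> D)"; cases "card (cofaces X f \<inter> D) - 1") auto
      then obtain t where t: "cofaces X f \<inter> D = {t}" by (auto simp: card_1_singleton_iff)
      then have tD: "t \<in> D" "t \<in> cofaces X f" by blast+
      then have tD: "t \<in> D" "f \<subset> t" "card t = 4" "t \<in> simplices X 4"
        using inv'(3) unfolding cofaces_def by blast+
      have fG: "f \<in> G" using inv'(4) f(1) tD by blast
      have uniq: "t' = t" if "t' \<in> D" "f \<subset> t'" for t'
      proof -
        have "t' \<in> cofaces X f" using that inv'(3) f(1) by (auto simp: cofaces_def)
        then show ?thesis using t that by blast
      qed
      have "inv (G - {f}) (D - {t})"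
        unfolding inv_def
      proof (intro conjI allI impI)
        show "F \<subseteq> G - {f}" "G - {f} \<subseteq> simplices X 3" "D - {t} \<subseteq> simplices X 4" using inv'(1-3) f by auto
        show "\<forall>t'\<in>D - {t}. \<forall>g\<in>simplices X 3. g \<subset> t' \<longrightarrow> g \<in> G - {f}" using inv'(4) uniq by blast
        have "abs_collapse (?Y G D) (?Y (G - {f}) (D - {t}))"
          unfolding abs_collapse_def
        proof (intro exI conjI)
          show "f \<in> ?Y G D" "t \<in> ?Y G D" "f \<subset> t" "card t = Suc (card f)" using fG tD f by auto
          show "\<forall>\<rho>\<in>?Y G D. f \<subset> \<rho> \<longrightarrow> \<rho> = t"
          proof (intro ballI impI)
            fix \<rho> assume \<rho>: "\<rho> \<in> ?Y G D" "f \<subset> \<rho>"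
            then have "\<rho> \<in> X" using inv'(2,3) by auto
            then have "card f < card \<rho>" using \<rho>(2) X(2) by (metis face_closedD(1) psubset_card_mono)
            then have "\<rho> \<in> D" using \<rho> inv'(2) f(1) by auto
            then show "\<rho> = t" using uniq \<rho>(2) by blast
          qed
          show "?Y (G - {f}) (D - {t}) = ?Y G D - {f, t}"
            using f(1) tD inv'(2,3) by auto
        qed
        then show "abs_collapse\<^sup>*\<^sup>* X (?Y (G - {f}) (D - {t}))"
          using inv'(5) by (meson rtranclp.rtrancl_into_rtrancl)
        fix a assume a: "\<forall>g\<in>simplices X 3 - (G - {f}). bdry X a g = 0"
        then have a0: "\<forall>t\<in>simplices X 4 - D. a t = 0" using inv'(6) by blast
        \<comment> \<open>The cofaces of \<open>f\<close> other than \<open>t\<close> were removed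
          earlier, and there \<open>a\<close> already vanishes.\<close>
        have "bdry X a f = (\<Sum>t'\<in>cofaces X f. if t' = t then a t' else 0)"
          unfolding bdry_def
        proof (rule sum.cong[OF refl])
          fix t' assume t': "t' \<in> cofaces X f"
          then have "t' \<in> simplices X 4" using f(1) by (auto simp: cofaces_def)
          then have "a t' = 0" if "t' \<noteq> t" using a0 t t' that by blast
          then show "a t' = (if t' = t then a t' else 0)" by auto
        qed
        also have "\<dots> = a t" using finite_cofaces[OF X(1), of f] t by (auto simp: sum.delta)
        finally have "a t = 0" using a f(1) by auto
        then show "\<forall>t'\<in>simplices X 4 - (D - {t}). a t' = 0" using a0 by auto
      qed
      moreover have "card (D - {t}) < card D"
        using tD finite_subset[OF inv'(3)] X(1) by (intro psubset_card_mono) auto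
      ultimately show ?thesis using less.hyps by blast
    qed
  qed
  then obtain G where G: "inv G {}" using start by blast
  note G' = invD[OF G]
  have "G \<subseteq> F"
  proof (rule ccontr)
    assume "\<not> G \<subseteq> F"
    then obtain f where f: "f \<in> G" "f \<notin> F" "f \<in> simplices X 3" using G'(2) by blast
    then have fX: "f \<in> X" "card f = 3" by auto
    then have finf: "finite f" using X(2) by (auto dest: face_closedD)
    have fe: "f - {v} \<in> simplices X 2" if "v \<in> f" for v
    proof -
      have "card (f - {v}) = 2" using fX that by simp
      moreover from this have "f - {v} \<noteq> {}" by (metis card.empty zero_neq_numeral)
      ultimately show ?thesis using face_closedD(3)[OF X(2) fX(1), of "f - {v}"] by auto
    qed
    have "\<forall>v\<in>f. \<exists>z. (\<forall>g. g \<notin> F \<longrightarrow> z g = 0) \<and>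
        (\<forall>e'\<in>simplices X 2 - T. bdry X z e' = of_bool (e' = f - {v}))" using fil(7) fe by blast
    from bchoice[OF this] obtain z where z0: "\<forall>v\<in>f. (\<forall>g. g \<notin> F \<longrightarrow> z v g = 0) \<and>
        (\<forall>e'\<in>simplices X 2 - T. bdry X (z v) e' = of_bool (e' = f - {v}))" by (elim exE)
    then have z: "\<And>v g. v \<in> f \<Longrightarrow> g \<notin> F \<Longrightarrow> z v g = 0"
      "\<And>v e'. v \<in> f \<Longrightarrow> e' \<in> simplices X 2 - T \<Longrightarrow> bdry X (z v) e' = of_bool (e' = f - {v})"
      by blast+
    \<comment> \<open>The chains \<open>z v\<close> move the three edges of \<open>f\<close> into
      \<open>T\<close>, so the boundary of \<open>c\<close> is carried by \<open>T\<close>. Being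
      itself a cycle, that boundary is zero, and \<open>c\<close> is a 2-cycle.\<close>
    define c where "c g = of_bool (g = f) + (\<Sum>v\<in>f. z v g)" for g
    have bsum: "bdry X c e = of_bool (e \<subset> f \<and> card f = Suc (card e)) + (\<Sum>v\<in>f. bdry X (z v) e)" for e
    proof -
      have "bdry X (\<lambda>g. \<Sum>v\<in>f. z v g) e = (\<Sum>v\<in>f. bdry X (z v) e)"
        unfolding bdry_def by (rule sum.swap)
      then show ?thesis unfolding c_def by (simp add: bdry_add bdry_single[OF X(1) fX(1)])
    qed
    have off: "bdry X c e = 0" if e: "e \<in> simplices X 2" "e \<notin> T" for e
    proof -
      have "(\<Sum>v\<in>f. bdry X (z v) e) = (\<Sum>v\<in>f. of_bool (e = f - {v}))"
        using z(2) e by (intro sum.cong) auto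
      also have "\<dots> = of_bool (e \<in> (\<lambda>v. f - {v}) ` f)"
      proof (cases "e \<in> (\<lambda>v. f - {v}) ` f")
        case True
        then obtain u where u: "u \<in> f" "e = f - {u}" by blast
        have "(\<Sum>v\<in>f. of_bool (e = f - {v})) = (\<Sum>v\<in>f. if v = u then 1 else 0 :: bit)"
          using u by (intro sum.cong) auto
        then show ?thesis using True u finf by (simp add: sum.delta)
      next
        case False
        then have "(\<Sum>v\<in>f. of_bool (e = f - {v})) = (\<Sum>v\<in>f. 0 :: bit)" by (intro sum.cong) auto
        then show ?thesis using False by simp
      qed
      finally show ?thesis using bsum[of e] facets_eq_image[OF finf] by auto
    qed
    have "bdry X c e = 0" if e: "e \<in> simplices X 2" for e
    proof (rule tree_has_no_cycles[OF X(1,2) T2 _ off _ e])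
      show "\<not> cyclic_rel (graph_rel T)" using tree by (simp add: abs_tree_def)
      show "bdry X (bdry X c) \<sigma> = 0" if "\<sigma> \<in> simplices X 1" for \<sigma> using bdry_bdry[OF X(1,2)] that by auto
    qed
    then obtain a where a: "\<forall>g\<in>simplices X 3. bdry X a g = c g" using fill_2_cycle by blast
    have "c g = 0" if "g \<notin> G" for g
    proof -
      have "g \<notin> F" "g \<noteq> f" using that G'(1) f by auto
      then show ?thesis using z(1) by (simp add: c_def)
    qed
    then have "bdry X a g = 0" if "g \<in> simplices X 3 - G" for g using a that by auto
    \<comment> \<open>The boundary \<open>c\<close> of \<open>a\<close> vanishes on every removed
      triangle, and no tetrahedron is left; so the last clause of \<open>inv\<close> gives
      \<open>a = 0\<close>, although \<open>c f = 1\<close>.\<close>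
    then have "\<forall>t\<in>simplices X 4. a t = 0" using G'(6)[of a] by auto
    then have "bdry X a f = 0"
      unfolding bdry_def using f by (intro sum.neutral) (auto simp: cofaces_def)
    moreover have "c f = 1" using z(1) f by (simp add: c_def)
    ultimately show False using a f by auto
  qed
  then have "G = F" using G'(1) by auto
  then have "abs_collapse\<^sup>*\<^sup>* X (simplices X 1 \<union> simplices X 2 \<union> F)" using G'(5) by simp
  also have "abs_collapse\<^sup>*\<^sup>* (simplices X 1 \<union> simplices X 2 \<union> F) (simplices X 1 \<union> T)" by (rule fil(5))
  finally have 1: "abs_collapse\<^sup>*\<^sup>* X (simplices X 1 \<union> T)" .
  let ?V = "{v. {v} \<in> X}"
  have V: "(\<lambda>v. {v}) ` ?V = simplices X 1" by (auto simp: card_1_singleton_iff)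
  have "\<exists>v. abs_collapse\<^sup>*\<^sup>* ((\<lambda>v. {v}) ` ?V \<union> T) {{v}}"
  proof (rule tree_collapses_to_vertex)
    show "finite T" using X(1) T2 by (auto intro: finite_subset)
    have "finite ((\<lambda>v. {v}) ` ?V)" unfolding V using X(1) by simp
    then show "finite ?V" by (rule finite_imageD) (simp add: inj_on_def)
    obtain S where "S \<in> X" using X(4) by blast
    then obtain v where "v \<in> S" using X(2) by (metis all_not_in_conv face_closedD(2))
    then have "{v} \<in> X" using face_closedD(3)[OF X(2) \<open>S \<in> X\<close>, of "{v}"] by auto
    then show "?V \<noteq> {}" by blast
    show "card e = 2 \<and> e \<subseteq> ?V" if "e \<in> T" for e
      using that T2 face_closedD(3)[OF X(2), of e] by auto
    show "(u, v) \<in> (graph_rel T)\<^sup>*" if "u \<in> ?V" "v \<in> ?V" for u v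
      using that tree by (auto simp: abs_tree_def)
    show "\<not> cyclic_rel (graph_rel T)" using tree by (simp add: abs_tree_def)
  qed
  then show ?thesis using 1 V by (metis rtranclp_trans)
qed

section \<open>Generic points and the parity of cones\<close>

definition hull_ind :: "pt set \<Rightarrow> pt \<Rightarrow> bit" where
  "hull_ind C x = of_bool (x \<in> convex hull C)"

lemma weighted_sum_in_convex_hull:
  fixes u :: "'a::real_vector \<Rightarrow> real"
  assumes "finite Q" "S \<subseteq> Q" "\<And>v. v \<in> Q \<Longrightarrow> 0 \<le> u v" "sum u Q = 1" "\<And>v. v \<in> Q - S \<Longrightarrow> u v = 0"
  shows "(\<Sum>v\<in>Q. u v *\<^sub>R v) \<in> convex hull S"
proof -
  have fin: "finite S" using assms(1,2) by (rule finite_subset[rotated])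
  have "sum u Q = sum u S" using assms(1,2,5) by (intro sum.mono_neutral_right) auto
  moreover have "(\<Sum>v\<in>Q. u v *\<^sub>R v) = (\<Sum>v\<in>S. u v *\<^sub>R v)"
    using assms(1,2,5) by (intro sum.mono_neutral_right) auto
  ultimately show ?thesis
    unfolding convex_hull_finite[OF fin] using assms(2,3,4) by (intro CollectI exI[of _ u]) auto
qed

text \<open>As in the simplex method: with \<open>u\<close> and \<open>\<alpha>\<close> the barycentric coordinates of \<open>x\<close> and \<open>a\<close>, the
  vertex to exchange for \<open>a\<close> is the minimiser of \<open>u v / \<alpha> v\<close> over \<open>\<alpha> v > 0\<close>.\<close>

lemma convex_hull_pivot:
  fixes x :: pt
  assumes P: "finite P" "card P = 5"
    and gen: "\<And>R. R \<subseteq> P \<Longrightarrow> card R \<le> 3 \<Longrightarrow> x \<notin> convex hull R"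
    and a: "a \<in> P" and x: "x \<in> convex hull (P - {a})"
  shows "\<exists>!b. b \<in> P - {a} \<and> x \<in> convex hull (P - {b})"
proof -
  define Q where "Q = P - {a}"
  have Q: "finite Q" "card Q = 4" "a \<notin> Q" "P = insert a Q" using P a by (auto simp: Q_def)
  obtain u where u: "\<And>v. v \<in> Q \<Longrightarrow> 0 \<le> u v" "sum u Q = 1" "(\<Sum>v\<in>Q. u v *\<^sub>R v) = x"
    using x convex_hull_finite[OF Q(1)] unfolding Q_def by blast
  \<comment> \<open>A zero weight would put \<open>x\<close> in the hull of three points, against
    genericity.\<close>
  have upos: "0 < u v" if v: "v \<in> Q" for v
  proof (rule ccontr)
    assume "\<not> 0 < u v"
    then have "u v = 0" using u(1)[OF v] by simp
    then have "(\<Sum>v\<in>Q. u v *\<^sub>R v) \<in> convex hull (Q - {v})"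
      using Q(1) u by (intro weighted_sum_in_convex_hull) auto
    then show False using gen[of "Q - {v}"] u(3) Q v by auto
  qed
  \<comment> \<open>In a degenerate \<open>Q\<close>, Caratheodory's theorem would again put
    \<open>x\<close> in the hull of three points.\<close>
  have indep: "\<not> affine_dependent Q"
  proof
    assume dep: "affine_dependent Q"
    have "aff_dim Q \<noteq> int (card Q) - 1" using dep Q(1) affine_independent_iff_card by blast
    then have "aff_dim Q + 1 \<le> 3" using aff_dim_le_card[OF Q(1)] Q(2) by simp
    moreover obtain S where "S \<subseteq> Q" "int (card S) \<le> aff_dim Q + 1" "x \<in> convex hull S"
      using x caratheodory_aff_dim[of Q] unfolding Q_def by blast
    ultimately show False using gen[of S] Q(4) by auto
  qed
  then have "aff_dim Q = 3" using Q(2) affine_independent_iff_card[of Q] by simp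
  then have "affine hull Q = UNIV" using aff_dim_eq_full[of Q] by simp
  then obtain \<alpha> where \<alpha>: "sum \<alpha> Q = 1" "(\<Sum>v\<in>Q. \<alpha> v *\<^sub>R v) = a"
    using affine_hull_finite[OF Q(1)] by blast
  have unique: "c v = 0" if "sum c Q = 0" "(\<Sum>v\<in>Q. c v *\<^sub>R v) = 0" "v \<in> Q" for c v
    using indep affine_dependent_explicit_finite[OF Q(1)] that by blast
  \<comment> \<open>Weight \<open>t\<close> is moved onto \<open>a\<close> and
    \<open>t * \<alpha> v\<close> is taken from each \<open>v\<close>. Since \<open>a\<close> is the
    combination of \<open>Q\<close> with coefficients \<open>\<alpha>\<close>, the point represented
    is still \<open>x\<close>.\<close>
  have inhull: "x \<in> convex hull S"
    if t: "0 \<le> t" "\<And>v. v \<in> Q \<Longrightarrow> t * \<alpha> v \<le> u v" and S: "S \<subseteq> P" "a \<in> S" "\<And>v. v \<in> Q - S \<Longrightarrow> t * \<alpha> v = u v" for t S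
  proof -
    define w where "w v = (if v = a then t else u v - t * \<alpha> v)" for v
    have eq: "sum w Q = (\<Sum>v\<in>Q. u v - t * \<alpha> v)"
      "(\<Sum>v\<in>Q. w v *\<^sub>R v) = (\<Sum>v\<in>Q. (u v - t * \<alpha> v) *\<^sub>R v)"
      using Q(3) by (auto simp: w_def intro!: sum.cong)
    have "sum w P = t + (\<Sum>v\<in>Q. u v - t * \<alpha> v)" using Q eq by (simp add: w_def)
    also have "\<dots> = 1" using u \<alpha> by (simp add: sum_subtractf flip: sum_distrib_left)
    finally have 1: "sum w P = 1" .
    have "(\<Sum>v\<in>P. w v *\<^sub>R v) = t *\<^sub>R a + (\<Sum>v\<in>Q. (u v - t * \<alpha> v) *\<^sub>R v)"
      using Q eq by (simp add: w_def)
    also have "(\<Sum>v\<in>Q. (u v - t * \<alpha> v) *\<^sub>R v) = x - t *\<^sub>R a"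
      by (simp add: scaleR_diff_left sum_subtractf u(3) flip: scaleR_scaleR scaleR_sum_right \<alpha>(2))
    finally have 2: "(\<Sum>v\<in>P. w v *\<^sub>R v) = x" by simp
    have "(\<Sum>v\<in>P. w v *\<^sub>R v) \<in> convex hull S"
      using P(1) S(1) _ 1
    proof (rule weighted_sum_in_convex_hull)
      show "0 \<le> w v" if "v \<in> P" for v using that t Q(4) by (auto simp: w_def)
      show "w v = 0" if "v \<in> P - S" for v using that S Q(4) by (auto simp: w_def)
    qed
    then show ?thesis using 2 by simp
  qed
  \<comment> \<open>Conversely, every representation of \<open>x\<close> without \<open>b\<close>
    arises in this way, with \<open>t\<close> the weight of \<open>a\<close>, because barycentric
    coordinates in \<open>Q\<close> are unique.\<close>
  have weights: "\<exists>t>0. (\<forall>v\<in>Q. t * \<alpha> v \<le> u v) \<and> t * \<alpha> b = u b"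
    if b: "b \<in> Q" "x \<in> convex hull (P - {b})" for b
  proof -
    have fin: "finite (P - {b})" using P by simp
    obtain w where w: "\<And>v. v \<in> P - {b} \<Longrightarrow> 0 \<le> w v" "sum w (P - {b}) = 1" "(\<Sum>v\<in>P - {b}. w v *\<^sub>R v) = x"
      using b(2) convex_hull_finite[OF fin] by blast
    have Pb: "P - {b} = insert a (Q - {b})" "a \<notin> Q - {b}" using Q b by auto
    define c where "c v = (if v = b then 0 else w v) + w a * \<alpha> v - u v" for v
    have "(\<Sum>v\<in>Q. if v = b then 0 else w v) = sum w (Q - {b})"
      using Q(1) b(1) by (subst sum.remove[of _ b]) (auto intro!: sum.cong)
    moreover have "sum w (P - {b}) = w a + sum w (Q - {b})" using Pb Q(1) by simp
    ultimately have c1: "sum c Q = 0"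
      using w(2) u(2) \<alpha>(1) by (simp add: c_def sum_subtractf sum.distrib flip: sum_distrib_left)
    have "(\<Sum>v\<in>Q. (if v = b then 0 else w v) *\<^sub>R v) = (\<Sum>v\<in>Q - {b}. w v *\<^sub>R v)"
      using Q(1) b(1) by (subst sum.remove[of _ b]) (auto intro!: sum.cong)
    moreover have "x = w a *\<^sub>R a + (\<Sum>v\<in>Q - {b}. w v *\<^sub>R v)" using w(3) Pb Q(1) by simp
    moreover have "(\<Sum>v\<in>Q. c v *\<^sub>R v) = (\<Sum>v\<in>Q. (if v = b then 0 else w v) *\<^sub>R v)
        + w a *\<^sub>R (\<Sum>v\<in>Q. \<alpha> v *\<^sub>R v) - (\<Sum>v\<in>Q. u v *\<^sub>R v)"
      by (simp add: c_def sum_subtractf sum.distrib scaleR_diff_left scaleR_add_left scaleR_sum_right)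
    ultimately have c2: "(\<Sum>v\<in>Q. c v *\<^sub>R v) = 0" using u(3) \<alpha>(2) by simp
    have c0: "c v = 0" if "v \<in> Q" for v using unique[OF c1 c2 that] .
    have wa: "0 \<le> w a" using w(1)[of a] Pb by auto
    have eqb: "w a * \<alpha> b = u b" using c0[OF b(1)] by (simp add: c_def)
    moreover have "w a \<noteq> 0" using eqb upos[OF b(1)] by auto
    moreover have "w a * \<alpha> v \<le> u v" if v: "v \<in> Q" for v
      using c0[OF v] w(1)[of v] v Q eqb by (cases "v = b") (auto simp: c_def)
    ultimately show ?thesis using wa by (intro exI[of _ "w a"]) auto
  qed
  have "\<exists>b. b \<in> Q \<and> x \<in> convex hull (P - {b})"
  proof -
    let ?A = "{v \<in> Q. \<alpha> v > 0}"
    have ne: "?A \<noteq> {}"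
    proof
      assume "?A = {}"
      then have "sum \<alpha> Q \<le> 0" by (intro sum_nonpos) (auto simp: not_less)
      then show False using \<alpha>(1) by simp
    qed
    have finA: "finite ?A" using Q(1) by simp
    obtain b where b: "b \<in> ?A" and min: "\<And>v. v \<in> ?A \<Longrightarrow> u b / \<alpha> b \<le> u v / \<alpha> v"
      using ex_is_arg_min_if_finite[OF finA ne, of "\<lambda>v. u v / \<alpha> v"]
      by (auto simp: is_arg_min_linorder)
    define t where "t = u b / \<alpha> b"
    have t0: "0 \<le> t" using b upos[of b] by (simp add: t_def)
    have "t * \<alpha> v \<le> u v" if v: "v \<in> Q" for v
    proof (cases "\<alpha> v > 0")
      case True
      then show ?thesis using min[of v] v by (simp add: t_def pos_le_divide_eq)
    next
      case False
      then have "t * \<alpha> v \<le> 0" using t0 by (simp add: mult_nonneg_nonpos)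
      then show ?thesis using u(1)[OF v] by simp
    qed
    moreover have "t * \<alpha> b = u b" using b by (simp add: t_def)
    ultimately have "x \<in> convex hull (P - {b})"
      using t0 b Q by (intro inhull[of t]) auto
    then show ?thesis using b by blast
  qed
  moreover have "b = b'" if b: "b \<in> Q" "x \<in> convex hull (P - {b})"
    and b': "b' \<in> Q" "x \<in> convex hull (P - {b'})" for b b'
  proof (rule ccontr)
    assume neq: "b \<noteq> b'"
    obtain t where t: "t > 0" "\<And>v. v \<in> Q \<Longrightarrow> t * \<alpha> v \<le> u v" "t * \<alpha> b = u b" using weights[OF b] by blast
    obtain t' where t': "t' > 0" "\<And>v. v \<in> Q \<Longrightarrow> t' * \<alpha> v \<le> u v" "t' * \<alpha> b' = u b'" using weights[OF b'] by blast
    have "\<alpha> b > 0" "\<alpha> b' > 0"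
      using t(1,3) t'(1,3) upos[OF b(1)] upos[OF b'(1)] by (metis zero_less_mult_pos)+
    moreover have "t' * \<alpha> b \<le> t * \<alpha> b" "t * \<alpha> b' \<le> t' * \<alpha> b'" using t t' b b' by auto
    \<comment> \<open>Both vertices attain the minimal ratio, so both weights drop to zero together
      and \<open>x\<close> would lie in the hull of the remaining three points.\<close>
    ultimately have "t = t'" by simp
    then have "x \<in> convex hull (P - {b, b'})"
      using t t' b b' Q by (intro inhull[of t]) auto
    moreover have "card (P - {b, b'}) = 3" using P b b' neq Q by (simp add: card_Diff_subset)
    ultimately show False using gen[of "P - {b, b'}"] by auto
  qed
  ultimately show ?thesis unfolding Q_def by blast
qed

text \<open>If \<open>x\<close> lies in one of the five tetrahedra, the pivot provides exactly one
  other. So it lies in none or in two of them.\<close>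

lemma sum_hull_ind_zero:
  fixes x :: pt
  assumes P: "finite P" "card P = 5"
    and gen: "\<And>R. R \<subseteq> P \<Longrightarrow> card R \<le> 3 \<Longrightarrow> x \<notin> convex hull R"
  shows "(\<Sum>v\<in>P. hull_ind (P - {v}) x) = 0"
proof -
  let ?B = "{v \<in> P. x \<in> convex hull (P - {v})}"
  have sum: "(\<Sum>v\<in>P. hull_ind (P - {v}) x) = of_nat (card ?B)"
    unfolding hull_ind_def using P(1) by (simp add: of_bool_def sum.If_cases Int_def)
  show ?thesis
  proof (cases "?B = {}")
    case True
    show ?thesis unfolding sum True by simp
  next
    case False
    then obtain a where a: "a \<in> P" "x \<in> convex hull (P - {a})" by blast
    obtain b where b: "b \<in> P - {a}" "x \<in> convex hull (P - {b})"
      and uniq: "\<And>c. c \<in> P - {a} \<Longrightarrow> x \<in> convex hull (P - {c}) \<Longrightarrow> c = b"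
      using convex_hull_pivot[OF P gen a] by blast
    have "?B = {a, b}" using a b uniq by blast
    then have "card ?B = 2" using b by auto
    then show ?thesis using sum by simp
  qed
qed

text \<open>The point avoids all points, lines and planes spanned by \<open>V\<close>. Affine hulls
  are taken instead of convex ones because they admit the exchange argument.\<close>

definition generic :: "pt set \<Rightarrow> pt \<Rightarrow> bool" where
  "generic V x \<longleftrightarrow> (\<forall>R\<subseteq>V. card R \<le> 3 \<longrightarrow> x \<notin> affine hull R)"

lemma genericD: "generic V x \<Longrightarrow> R \<subseteq> V \<Longrightarrow> card R \<le> 3 \<Longrightarrow> x \<notin> affine hull R"
  by (simp add: generic_def)

lemma generic_convex: "generic V x \<Longrightarrow> R \<subseteq> V \<Longrightarrow> card R \<le> 3 \<Longrightarrow> x \<notin> convex hull R"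
  using genericD convex_hull_subset_affine_hull by blast

lemma generic_mono: "generic V x \<Longrightarrow> W \<subseteq> V \<Longrightarrow> generic W x"
  unfolding generic_def by (meson subset_trans)

lemma generic_notin: "generic V x \<Longrightarrow> x \<notin> V"
  using genericD[of V x "{x}"] by auto

text \<open>The flats to be avoided form a finite union of null sets, which cannot cover a nonempty
  open set.\<close>

lemma generic_exists:
  assumes V: "finite V" and U: "open U" "U \<noteq> {}"
  obtains x where "x \<in> U" "generic V x"
proof -
  let ?N = "\<Union>R\<in>{R. R \<subseteq> V \<and> card R \<le> 3}. affine hull R"
  have "negligible (affine hull R)" if "R \<subseteq> V" "card R \<le> 3" for R
  proof -
    have "finite R" using that V finite_subset by blast
    then have "interior (affine hull R) = {}" using that by (intro empty_interior_affine_hull) auto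
    then show ?thesis by (simp add: negligible_convex_interior affine_imp_convex)
  qed
  moreover have "finite {R. R \<subseteq> V \<and> card R \<le> 3}" using V by simp
  ultimately have "negligible ?N" by (intro negligible_Union) auto
  then have "\<not> U \<subseteq> ?N" using U open_not_negligible negligible_subset by blast
  then show thesis using that unfolding generic_def by blast
qed

text \<open>Steinitz exchange: \<open>r\<close> has a nonzero coefficient in the combination for
  \<open>x\<close>, so the combination can be solved for \<open>r\<close>.\<close>

lemma affine_hull_exchange:
  fixes x r :: pt
  assumes R: "finite R" and x: "x \<in> affine hull (insert r R)" "x \<notin> affine hull R"
  shows "r \<in> affine hull (insert x R)"
proof -
  have "r \<notin> R" using x by (metis insert_absorb)
  have "x \<notin> R" using x(2) by (meson hull_inc)
  obtain u where u: "sum u (insert r R) = 1" "(\<Sum>v\<in>insert r R. u v *\<^sub>R v) = x"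
    using x(1) affine_hull_finite[of "insert r R"] R by auto
  have s: "u r + sum u R = 1" "u r *\<^sub>R r + (\<Sum>v\<in>R. u v *\<^sub>R v) = x"
    using u R \<open>r \<notin> R\<close> by auto
  have ur: "u r \<noteq> 0"
  proof
    assume "u r = 0"
    then have "x \<in> affine hull R" using s affine_hull_finite[OF R] by auto
    then show False using x(2) by simp
  qed
  define w where "w v = (if v = x then 1 / u r else - u v / u r)" for v
  have 1: "sum w R = (\<Sum>v\<in>R. - u v / u r)" "(\<Sum>v\<in>R. w v *\<^sub>R v) = (\<Sum>v\<in>R. (- u v / u r) *\<^sub>R v)"
    using \<open>x \<notin> R\<close> by (auto simp: w_def intro!: sum.cong)
  have "sum w (insert x R) = 1 / u r + (\<Sum>v\<in>R. - u v / u r)" using R \<open>x \<notin> R\<close> 1 by (simp add: w_def)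
  also have "\<dots> = (1 - sum u R) / u r" by (simp add: diff_divide_distrib sum_negf sum_divide_distrib)
  also have "\<dots> = 1" using s(1) ur by (simp add: field_simps)
  finally have a: "sum w (insert x R) = 1" .
  have "(\<Sum>v\<in>insert x R. w v *\<^sub>R v) = (1 / u r) *\<^sub>R x + (\<Sum>v\<in>R. (- u v / u r) *\<^sub>R v)"
    using R \<open>x \<notin> R\<close> 1 by (simp add: w_def)
  also have "(\<Sum>v\<in>R. (- u v / u r) *\<^sub>R v) = - (1 / u r) *\<^sub>R (\<Sum>v\<in>R. u v *\<^sub>R v)"
    unfolding scaleR_sum_right by (intro sum.cong) auto
  also have "(\<Sum>v\<in>R. u v *\<^sub>R v) = x - u r *\<^sub>R r" using s(2) by (simp add: algebra_simps)
  also have "(1 / u r) *\<^sub>R x + - (1 / u r) *\<^sub>R (x - u r *\<^sub>R r) = r"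
    using ur by (simp add: scaleR_diff_right)
  finally have "(\<Sum>v\<in>insert x R. w v *\<^sub>R v) = r" .
  then show ?thesis using a affine_hull_finite[of "insert x R"] R by auto
qed

lemma generic_insertI:
  assumes V: "finite V" and x: "generic V x"
    and r: "\<And>R. R \<subseteq> V \<Longrightarrow> card R \<le> 2 \<Longrightarrow> r \<notin> affine hull (insert x R)"
  shows "generic (insert r V) x"
  unfolding generic_def
proof (intro allI impI notI)
  fix R assume R: "R \<subseteq> insert r V" "card R \<le> 3" "x \<in> affine hull R"
  show False
  proof (cases "r \<in> R")
    case False
    then show False using genericD[OF x, of R] R by auto
  next
    case True
    have fin: "finite R" using R(1) V finite_subset by blast
    let ?R = "R - {r}"
    have c: "card ?R \<le> 2" "?R \<subseteq> V" "insert r ?R = R" using True R fin by auto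
    then have "x \<notin> affine hull ?R" using genericD[OF x, of ?R] by auto
    then have "r \<in> affine hull (insert x ?R)"
      using affine_hull_exchange[of ?R x r] R(3) c fin by auto
    then show False using r c by blast
  qed
qed

text \<open>Genericity does not depend on the order of choice: if \<open>r\<close> is generic with
  respect to \<open>x\<close> and \<open>V\<close>, then adding \<open>r\<close> to \<open>V\<close>
  leaves \<open>x\<close> generic.\<close>

lemma generic_insert_sym:
  assumes "finite V" "generic V x" "generic (insert x V) r"
  shows "generic (insert r V) x"
proof (rule generic_insertI[OF assms(1,2)])
  fix R assume R: "R \<subseteq> V" "card R \<le> 2"
  have "card (insert x R) \<le> 3" using R finite_subset[OF R(1) assms(1)] by (simp add: card_insert_if)
  then show "r \<notin> affine hull (insert x R)" using genericD[OF assms(3), of "insert x R"] R by auto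
qed

lemma generic_apex_exists:
  assumes "finite V" "generic V x" "open U" "U \<noteq> {}"
  obtains p where "p \<in> U" "p \<notin> V" "generic (insert p V) x"
proof -
  have "finite (insert x V)" using assms(1) by simp
  then obtain p where p: "p \<in> U" "generic (insert x V) p" using generic_exists[OF _ assms(3,4)] by blast
  have "p \<notin> V" using generic_notin[OF p(2)] by blast
  then show thesis using that p generic_insert_sym[OF assms(1,2) p(2)] by blast
qed

section \<open>Cone counts and their independence of the apex\<close>

definition cone_count :: "pt set set \<Rightarrow> (pt set \<Rightarrow> bit) \<Rightarrow> pt \<Rightarrow> pt \<Rightarrow> bit" where
  "cone_count X z p x = (\<Sum>f\<in>simplices X 3. z f * hull_ind (insert p f) x)"

lemma cone_count_add: "cone_count X (\<lambda>f. z f + w f) p x = cone_count X z p x + cone_count X w p x"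
  by (simp add: cone_count_def sum.distrib distrib_right)

text \<open>Apply the five-point parity to \<open>p\<close> and the vertices of \<open>t\<close>:
  the number of cones over facets of \<open>t\<close> that contain \<open>x\<close> has the parity
  of membership of \<open>x\<close> in \<open>t\<close> itself.\<close>

lemma cone_count_bdry:
  assumes X: "finite X" "face_closed X" and p: "p \<notin> \<Union>X" and gen: "generic (insert p (\<Union>X)) x"
  shows "cone_count X (bdry X a) p x = (\<Sum>t\<in>simplices X 4. a t * hull_ind t x)"
proof -
  have "cone_count X (bdry X a) p x
      = (\<Sum>t\<in>simplices X (Suc 3). a t * (\<Sum>v\<in>t. hull_ind (insert p (t - {v})) x))"
    unfolding cone_count_def by (rule sum_bdry_mult[OF X]) simp
  also have "\<dots> = (\<Sum>t\<in>simplices X 4. a t * hull_ind t x)"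
  proof (rule sum.cong)
    fix t assume "t \<in> simplices X 4"
    then have t: "t \<in> X" "card t = 4" "finite t" "p \<notin> t" using X(2) p by (auto dest: face_closedD)
    have sub: "insert p t \<subseteq> insert p (\<Union>X)" using t(1) by blast
    have "(\<Sum>v\<in>insert p t. hull_ind (insert p t - {v}) x) = 0"
    proof (rule sum_hull_ind_zero)
      show "x \<notin> convex hull R" if "R \<subseteq> insert p t" "card R \<le> 3" for R
        using generic_convex[OF gen _ that(2)] that(1) sub by blast
    qed (use t in auto)
    moreover have "(\<Sum>v\<in>t. hull_ind (insert p t - {v}) x) = (\<Sum>v\<in>t. hull_ind (insert p (t - {v})) x)"
      using t(4) by (intro sum.cong refl arg_cong2[where f = hull_ind]) auto
    moreover have "insert p t - {p} = t" using t(4) by auto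
    ultimately have "hull_ind t x + (\<Sum>v\<in>t. hull_ind (insert p (t - {v})) x) = 0" using t by simp
    then show "a t * (\<Sum>v\<in>t. hull_ind (insert p (t - {v})) x) = a t * hull_ind t x"
      by (simp add: bit_add_eq_0_iff)
  qed simp
  finally show ?thesis .
qed

text \<open>By the five-point parity for \<open>p\<close>, \<open>q\<close> and \<open>f\<close>,
  the two cones over \<open>f\<close> differ by the tetrahedra joining \<open>p\<close> and
  \<open>q\<close> to the edges of \<open>f\<close>. Summed over \<open>z\<close>, each edge is
  weighted by its coefficient in the boundary, which is zero.\<close>

lemma cone_count_apex_generic:
  assumes X: "finite X" "face_closed X" and cyc: "\<And>e. e \<in> simplices X 2 \<Longrightarrow> bdry X z e = 0"
    and pq: "p \<notin> \<Union>X" "q \<notin> \<Union>X" "p \<noteq> q" and gen: "generic ({p, q} \<union> \<Union>X) x"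
  shows "cone_count X z p x = cone_count X z q x"
proof -
  let ?g = "\<lambda>e. hull_ind ({p, q} \<union> e) x"
  have "cone_count X z p x + cone_count X z q x
      = (\<Sum>f\<in>simplices X 3. z f * (hull_ind (insert p f) x + hull_ind (insert q f) x))"
    by (simp add: cone_count_def sum.distrib distrib_left)
  also have "\<dots> = (\<Sum>f\<in>simplices X (Suc 2). z f * (\<Sum>v\<in>f. ?g (f - {v})))"
  proof (rule sum.cong)
    fix f assume "f \<in> simplices X (Suc 2)"
    then have f: "f \<in> X" "card f = 3" "finite f" "p \<notin> f" "q \<notin> f" using X(2) pq by (auto dest: face_closedD)
    let ?P = "insert p (insert q f)"
    have sub: "?P \<subseteq> {p, q} \<union> \<Union>X" using f(1) by blast
    have "(\<Sum>v\<in>?P. hull_ind (?P - {v}) x) = 0"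
    proof (rule sum_hull_ind_zero)
      show "x \<notin> convex hull R" if "R \<subseteq> ?P" "card R \<le> 3" for R
        using generic_convex[OF gen _ that(2)] that(1) sub by blast
    qed (use f pq in auto)
    moreover have "(\<Sum>v\<in>?P. hull_ind (?P - {v}) x)
        = hull_ind (?P - {p}) x + (hull_ind (?P - {q}) x + (\<Sum>v\<in>f. hull_ind (?P - {v}) x))"
      using f pq by (simp del: insert_Diff_single)
    moreover have "?P - {p} = insert q f" "?P - {q} = insert p f" using f pq by auto
    moreover have "(\<Sum>v\<in>f. hull_ind (?P - {v}) x) = (\<Sum>v\<in>f. ?g (f - {v}))"
      using f by (intro sum.cong refl arg_cong2[where f = hull_ind]) auto
    ultimately have "hull_ind (insert q f) x + (hull_ind (insert p f) x + (\<Sum>v\<in>f. ?g (f - {v}))) = 0"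
      by metis
    then have "hull_ind (insert p f) x + hull_ind (insert q f) x = (\<Sum>v\<in>f. ?g (f - {v}))"
      unfolding bit_add3_eq_0_iff .
    then show "z f * (hull_ind (insert p f) x + hull_ind (insert q f) x) = z f * (\<Sum>v\<in>f. ?g (f - {v}))"
      by simp
  qed simp
  also have "\<dots> = (\<Sum>e\<in>simplices X 2. bdry X z e * ?g e)"
    by (rule sum_bdry_mult[OF X, symmetric]) simp
  also have "\<dots> = 0" using cyc by (intro sum.neutral) auto
  finally show ?thesis by (simp add: bit_add_eq_0_iff)
qed

text \<open>Together \<open>p\<close> and \<open>q\<close> may be in special position relative to
  \<open>x\<close>. Both are therefore compared with a third apex that is generic with respect to
  all the points involved.\<close>

lemma cone_count_apex:
  assumes X: "finite X" "face_closed X" and cyc: "\<And>e. e \<in> simplices X 2 \<Longrightarrow> bdry X z e = 0"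
    and p: "p \<notin> \<Union>X" "generic (insert p (\<Union>X)) x" and q: "q \<notin> \<Union>X" "generic (insert q (\<Union>X)) x"
  shows "cone_count X z p x = cone_count X z q x"
proof -
  let ?V = "\<Union>X"
  have finV: "finite ?V" using X by (auto dest: face_closedD)
  then have "finite ({p, q, x} \<union> ?V)" by simp
  then obtain r where r: "generic ({p, q, x} \<union> ?V) r" using generic_exists[of _ UNIV] by (metis UNIV_not_empty open_UNIV)
  have r': "r \<notin> ?V" "r \<noteq> p" "r \<noteq> q" using generic_notin[OF r] by auto
  have *: "generic ({s, r} \<union> ?V) x" if "generic (insert s ?V) x" "s \<in> {p, q}" for s
  proof -
    have "generic (insert x (insert s ?V)) r" by (rule generic_mono[OF r]) (use that(2) in auto)
    then have "generic (insert r (insert s ?V)) x"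
      using generic_insert_sym[of "insert s ?V" x r] finV that(1) by simp
    then show ?thesis by (rule generic_mono) auto
  qed
  have "cone_count X z p x = cone_count X z r x"
    by (rule cone_count_apex_generic[OF X cyc p(1) r'(1)]) (use r' * p in auto)
  also have "\<dots> = cone_count X z q x"
    by (rule cone_count_apex_generic[OF X cyc q(1) r'(1), symmetric]) (use r' * q in auto)
  finally show ?thesis .
qed

section \<open>Rays, segments and crossings of a triangle\<close>

text \<open>Solving \<open>y = u p + v b\<close> for the base point gives
  \<open>b = y + (u / v) (y - p)\<close>, where \<open>v\<close> is nonzero because \<open>y\<close>
  is not the apex: the ray from \<open>y\<close> away from \<open>p\<close> meets the base.\<close>

lemma in_cone_iff_ray:
  fixes y p :: "'a::real_vector"
  assumes "f \<noteq> {}" "y \<noteq> p"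
  shows "y \<in> convex hull (insert p f) \<longleftrightarrow> (\<exists>t\<ge>0. y + t *\<^sub>R (y - p) \<in> convex hull f)"
proof
  assume "y \<in> convex hull (insert p f)"
  then obtain u v b where uv: "u \<ge> 0" "v \<ge> 0" "u + v = 1" "b \<in> convex hull f" "y = u *\<^sub>R p + v *\<^sub>R b"
    unfolding convex_hull_insert[OF assms(1)] by blast
  have "v \<noteq> 0" using uv assms(2) by auto
  have "v *\<^sub>R (y + (u / v) *\<^sub>R (y - p)) = v *\<^sub>R y + u *\<^sub>R (y - p)"
    using \<open>v \<noteq> 0\<close> by (simp add: scaleR_add_right)
  also have "\<dots> = (u + v) *\<^sub>R y - u *\<^sub>R p" by (simp add: algebra_simps)
  also have "\<dots> = v *\<^sub>R b" using uv by simp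
  finally have "y + (u / v) *\<^sub>R (y - p) = b" using \<open>v \<noteq> 0\<close> by (simp only: scaleR_cancel_left) simp
  then show "\<exists>t\<ge>0. y + t *\<^sub>R (y - p) \<in> convex hull f" using uv by (intro exI[of _ "u / v"]) auto
next
  assume "\<exists>t\<ge>0. y + t *\<^sub>R (y - p) \<in> convex hull f"
  then obtain t where t: "t \<ge> 0" "y + t *\<^sub>R (y - p) \<in> convex hull f" by blast
  let ?b = "y + t *\<^sub>R (y - p)"
  have pos: "1 + t > 0" using t by simp
  have "(1 + t) *\<^sub>R ((t / (1 + t)) *\<^sub>R p + (1 / (1 + t)) *\<^sub>R ?b) = t *\<^sub>R p + ?b"
    using pos by (simp add: scaleR_add_right)
  also have "\<dots> = (1 + t) *\<^sub>R y" by (simp add: algebra_simps)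
  finally have "y = (t / (1 + t)) *\<^sub>R p + (1 / (1 + t)) *\<^sub>R ?b" using pos by (simp only: scaleR_cancel_left) simp
  moreover have "t / (1 + t) + 1 / (1 + t) = 1" using pos by (simp flip: add_divide_distrib)
  ultimately show "y \<in> convex hull (insert p f)"
    unfolding convex_hull_insert[OF assms(1)] using t pos
    by (intro CollectI exI[of _ "t / (1 + t)"] exI[of _ "1 / (1 + t)"] exI[of _ ?b] conjI) auto
qed

text \<open>Since \<open>x\<close> is the midpoint of \<open>p\<close> and \<open>x'\<close>, both
  rays run along one line, starting at parameter 0 for \<open>x\<close> and 1 for \<open>x'\<close>.
  The line meets the hull at most once because \<open>x\<close> is off the affine hull.\<close>

lemma hull_ind_crossing:
  assumes "f \<noteq> {}" and neq: "x \<noteq> x'" and x: "x \<notin> affine hull f" and x': "x' \<notin> convex hull f"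
    and p: "p = 2 *\<^sub>R x - x'"
  shows "hull_ind (insert p f) x + hull_ind (insert p f) x' = of_bool (closed_segment x x' \<inter> convex hull f \<noteq> {})"
proof -
  define d where "d = x' - x"
  let ?L = "\<lambda>s::real. x + s *\<^sub>R d"
  have d: "d \<noteq> 0" using neq by (simp add: d_def)
  have xp: "x - p = d" "x' - p = 2 *\<^sub>R d" by (simp_all add: p d_def scaleR_2)
  have np: "x \<noteq> p" "x' \<noteq> p" using d xp by auto
  have A: "x \<in> convex hull (insert p f) \<longleftrightarrow> (\<exists>s\<ge>0. ?L s \<in> convex hull f)"
    using in_cone_iff_ray[OF assms(1) np(1)] xp by simp
  have "x' \<in> convex hull (insert p f) \<longleftrightarrow> (\<exists>t\<ge>0. x' + t *\<^sub>R (2 *\<^sub>R d) \<in> convex hull f)"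
    using in_cone_iff_ray[OF assms(1) np(2)] xp by simp
  also have "\<dots> \<longleftrightarrow> (\<exists>s\<ge>1. ?L s \<in> convex hull f)"
  proof safe
    fix t :: real assume t: "t \<ge> 0" "x' + t *\<^sub>R (2 *\<^sub>R d) \<in> convex hull f"
    have "x' + t *\<^sub>R (2 *\<^sub>R d) = ?L (1 + 2 * t)" by (simp add: d_def algebra_simps)
    then show "\<exists>s\<ge>1. ?L s \<in> convex hull f" using t by (intro exI[of _ "1 + 2 * t"]) auto
  next
    fix s :: real assume s: "s \<ge> 1" "?L s \<in> convex hull f"
    have "((s - 1) / 2) *\<^sub>R (2 *\<^sub>R d) = (s - 1) *\<^sub>R d" by simp
    then have "x' + ((s - 1) / 2) *\<^sub>R (2 *\<^sub>R d) = ?L s" by (simp add: d_def algebra_simps)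
    then show "\<exists>t\<ge>0. x' + t *\<^sub>R (2 *\<^sub>R d) \<in> convex hull f"
      using s by (intro exI[of _ "(s - 1) / 2"]) auto
  qed
  finally have B: "x' \<in> convex hull (insert p f) \<longleftrightarrow> (\<exists>s\<ge>1. ?L s \<in> convex hull f)" .
  have C: "closed_segment x x' \<inter> convex hull f \<noteq> {} \<longleftrightarrow> (\<exists>s. 0 \<le> s \<and> s \<le> 1 \<and> ?L s \<in> convex hull f)"
  proof -
    have "(1 - s) *\<^sub>R x + s *\<^sub>R x' = ?L s" for s by (simp add: d_def algebra_simps)
    then have "closed_segment x x' = {?L s | s. 0 \<le> s \<and> s \<le> 1}" unfolding closed_segment_def by auto
    then show ?thesis by auto
  qed
  have uniq: "s = s'" if "?L s \<in> convex hull f" "?L s' \<in> convex hull f" for s s'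
  proof (rule ccontr)
    assume ne: "s \<noteq> s'"
    have in_aff: "?L s \<in> affine hull f" "?L s' \<in> affine hull f"
      using that convex_hull_subset_affine_hull by blast+
    \<comment> \<open>The coefficients are chosen to sum to 1 and to cancel \<open>d\<close>, so
      this point of the affine hull is \<open>x\<close>.\<close>
    have "(s' / (s' - s)) *\<^sub>R ?L s + (- s / (s' - s)) *\<^sub>R ?L s' \<in> affine hull f"
      using ne by (intro mem_affine[OF affine_affine_hull in_aff]) (simp flip: diff_divide_distrib)
    moreover have "(s' / (s' - s)) *\<^sub>R ?L s + (- s / (s' - s)) *\<^sub>R ?L s' =
        (s' / (s' - s) + - s / (s' - s)) *\<^sub>R x + (s' / (s' - s) * s + - s / (s' - s) * s') *\<^sub>R d"
      by (simp only: scaleR_add_right scaleR_add_left scaleR_scaleR) (simp add: algebra_simps)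
    moreover have "s' / (s' - s) + - s / (s' - s) = 1" using ne by (simp flip: diff_divide_distrib)
    moreover have "s' / (s' - s) * s + - s / (s' - s) * s' = 0" by simp
    ultimately show False using x by simp
  qed
  have not1: "?L 1 \<notin> convex hull f" using x' by (simp add: d_def)
  show ?thesis
  proof (cases "\<exists>s\<ge>0. ?L s \<in> convex hull f")
    case False
    then have "\<not> (\<exists>s\<ge>1. ?L s \<in> convex hull f)" "\<not> (\<exists>s. 0 \<le> s \<and> s \<le> 1 \<and> ?L s \<in> convex hull f)"
      by (meson order_trans zero_le_one)+
    then show ?thesis using False unfolding hull_ind_def A B C by auto
  next
    case True
    then obtain s where s: "s \<ge> 0" "?L s \<in> convex hull f" by blast
    have "s \<noteq> 1" using s not1 by metis
    have b: "(\<exists>s\<ge>1. ?L s \<in> convex hull f) \<longleftrightarrow> s \<ge> 1" using s uniq by blast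
    have c: "(\<exists>s. 0 \<le> s \<and> s \<le> 1 \<and> ?L s \<in> convex hull f) \<longleftrightarrow> s \<le> 1" using s uniq by blast
    show ?thesis
      using True \<open>s \<noteq> 1\<close> unfolding hull_ind_def A B C b c by (cases "s \<le> 1") auto
  qed
qed

text \<open>The apex \<open>2 x - x'\<close> lies on the line through \<open>x\<close> and \<open>x'\<close>, so both cone counts are
  numbers of intersections with nested rays, and these differ by the segment from \<open>x\<close> to \<open>x'\<close>.\<close>

lemma cone_count_crossing:
  assumes X: "finite X" "face_closed X" and x: "generic (\<Union>X) x" and x': "generic (insert x (\<Union>X)) x'"
  defines "p \<equiv> 2 *\<^sub>R x - x'"
  shows "p \<notin> \<Union>X" "generic (insert p (\<Union>X)) x" "generic (insert p (\<Union>X)) x'"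
    "cone_count X z p x + cone_count X z p x'
       = (\<Sum>f\<in>simplices X 3. z f * of_bool (closed_segment x x' \<inter> convex hull f \<noteq> {}))"
proof -
  let ?V = "\<Union>X"
  have finV: "finite ?V" using X by (auto dest: face_closedD)
  have x'V: "generic ?V x'" by (rule generic_mono[OF x']) auto
  have neq: "x \<noteq> x'" using generic_notin[OF x'] by auto
  have x'p: "x' = 2 *\<^sub>R x - p" by (simp add: p_def)
  have x'_line: "x' \<in> affine hull S" if "x \<in> affine hull S" "p \<in> affine hull S" for S
    using mem_affine[OF affine_affine_hull that, of 2 "-1"] by (simp add: x'p)
  have card3: "card (insert y R) \<le> 3" if "R \<subseteq> ?V" "card R \<le> 2" for R y
    using finite_subset[OF that(1) finV] that(2) by (simp add: card_insert_if)
  \<comment> \<open>A flat containing \<open>x\<close> and \<open>p\<close> also contains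
    \<open>x'\<close>, but \<open>x'\<close> is generic with respect to \<open>x\<close> as
    well.\<close>
  have no_line: "p \<notin> affine hull (insert x R)" if R: "R \<subseteq> ?V" "card R \<le> 2" for R
    using x'_line[of "insert x R"] genericD[OF x' _ card3[OF R]] R(1) hull_inc[of x "insert x R"]
    by (metis insertI1 insert_mono)
  show "p \<notin> ?V"
  proof
    assume "p \<in> ?V"
    then show False using no_line[of "{p}"] hull_inc[of p "{x, p}"] by auto
  qed
  show gx: "generic (insert p ?V) x" using generic_insertI[OF finV x no_line] .
  show gx': "generic (insert p ?V) x'"
  proof (rule generic_insertI[OF finV x'V])
    fix R assume R: "R \<subseteq> ?V" "card R \<le> 2"
    show "p \<notin> affine hull (insert x' R)"
    proof
      assume p_in: "p \<in> affine hull (insert x' R)"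
      have "(1/2) *\<^sub>R p + (1/2) *\<^sub>R x' \<in> affine hull (insert x' R)"
        by (rule mem_affine[OF affine_affine_hull p_in]) (auto intro: hull_inc)
      moreover have "(1/2) *\<^sub>R p + (1/2) *\<^sub>R x' = x"
        by (simp add: p_def scaleR_diff_right)
      ultimately have "x \<in> affine hull (insert x' R)" by simp
      moreover have "x \<notin> affine hull R" using genericD[OF x R(1)] R(2) by simp
      ultimately have "x' \<in> affine hull (insert x R)"
        using affine_hull_exchange[OF finite_subset[OF R(1) finV]] by blast
      then show False using genericD[OF x' _ card3[OF R]] R(1) by blast
    qed
  qed
  have "cone_count X z p x + cone_count X z p x'
      = (\<Sum>f\<in>simplices X 3. z f * (hull_ind (insert p f) x + hull_ind (insert p f) x'))"
    by (simp add: cone_count_def sum.distrib distrib_left)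
  also have "\<dots> = (\<Sum>f\<in>simplices X 3. z f * of_bool (closed_segment x x' \<inter> convex hull f \<noteq> {}))"
  proof (rule sum.cong[OF refl])
    fix f assume "f \<in> simplices X 3"
    then have f: "f \<in> X" "card f \<le> 3" "f \<noteq> {}" "f \<subseteq> ?V" by auto
    have "hull_ind (insert p f) x + hull_ind (insert p f) x' = of_bool (closed_segment x x' \<inter> convex hull f \<noteq> {})"
    proof (rule hull_ind_crossing[OF f(3) neq])
      show "x \<notin> affine hull f" using genericD[OF x f(4,2)] .
      show "x' \<notin> convex hull f" using generic_convex[OF x'V f(4,2)] .
    qed (simp add: p_def)
    then show "z f * (hull_ind (insert p f) x + hull_ind (insert p f) x')
        = z f * of_bool (closed_segment x x' \<inter> convex hull f \<noteq> {})" by simp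
  qed
  finally show "cone_count X z p x + cone_count X z p x'
      = (\<Sum>f\<in>simplices X 3. z f * of_bool (closed_segment x x' \<inter> convex hull f \<noteq> {}))" .
qed

section \<open>Geometric complexes in space\<close>

text \<open>Cells are represented by their vertex sets, so faces are subsets and dimension is
  cardinality minus one. The assumption \<open>hull_Int\<close> says that cells meet exactly in the
  face on their common vertices.\<close>

locale geometric_complex =
  fixes X :: "pt set set"
  assumes finite_X: "finite X" and closed_X: "face_closed X"
    and independent: "C \<in> X \<Longrightarrow> \<not> affine_dependent C"
    and hull_Int: "C \<in> X \<Longrightarrow> D \<in> X \<Longrightarrow> convex hull C \<inter> convex hull D = convex hull (C \<inter> D)"
begin

abbreviation "V \<equiv> \<Union>X"

lemmas finite_face = face_closedD(1)[OF closed_X]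

lemma finite_V: "finite V"
  using finite_X finite_face by blast

lemma card_le_4:
  assumes "C \<in> X"
  shows "card C \<le> 4"
proof (rule ccontr)
  assume "\<not> card C \<le> 4"
  then have "affine_dependent C"
    using finite_face[OF assms] by (intro affine_dependent_biggerset) auto
  then show False using independent[OF assms] by simp
qed

lemma generic_in_tetrahedron:
  assumes "generic V x" "C \<in> X" "x \<in> convex hull C"
  shows "card C = 4"
proof -
  have "\<not> card C \<le> 3" using generic_convex[OF assms(1), of C] assms(2,3) by blast
  then show ?thesis using card_le_4[OF assms(2)] by simp
qed

text \<open>The two hulls meet in the hull of their common vertices; a generic point in it forces
  four of these.\<close>

lemma generic_tetrahedron_unique:
  assumes x: "generic V x" and t: "t \<in> X" "x \<in> convex hull t" and t': "t' \<in> X" "x \<in> convex hull t'"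
  shows "t = t'"
proof -
  have "x \<in> convex hull (t \<inter> t')" using hull_Int[OF t(1) t'(1)] t t' by blast
  then have c: "\<not> card (t \<inter> t') \<le> 3" using generic_convex[OF x, of "t \<inter> t'"] t(1) by blast
  have "t \<inter> t' = t" by (rule card_seteq) (use finite_face[OF t(1)] card_le_4[OF t(1)] c in auto)
  moreover have "t \<inter> t' = t'" by (rule card_seteq) (use finite_face[OF t'(1)] card_le_4[OF t'(1)] c in auto)
  ultimately show ?thesis by simp
qed

lemma sum_tetrahedra:
  assumes x: "generic V x" and t: "t \<in> simplices X 4" "x \<in> convex hull t"
  shows "(\<Sum>s\<in>simplices X 4. a s * hull_ind s x) = a t"
proof -
  have "(\<Sum>s\<in>simplices X 4. a s * hull_ind s x) = (\<Sum>s\<in>simplices X 4. if s = t then a s else 0)"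
  proof (rule sum.cong[OF refl])
    fix s assume s: "s \<in> simplices X 4"
    then have "x \<in> convex hull s \<longleftrightarrow> s = t" using generic_tetrahedron_unique[OF x, of t s] t by blast
    then show "a s * hull_ind s x = (if s = t then a s else 0)" by (simp add: hull_ind_def)
  qed
  also have "\<dots> = a t" using finite_X t by (simp add: sum.delta)
  finally show ?thesis .
qed

lemma interior_tetrahedron:
  assumes t: "t \<in> simplices X 4"
  shows "interior (convex hull t) \<noteq> {}"
    and "convex hull t - interior (convex hull t) = (\<Union>v\<in>t. convex hull (t - {v}))"
proof -
  have ind: "\<not> affine_dependent t" using independent t by auto
  have "card t = Suc DIM(pt)" using t by simp
  then show ne: "interior (convex hull t) \<noteq> {}" using interior_convex_hull_eq_empty ind by blast
  have "finite t" using t finite_face by auto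
  then have "closure (convex hull t) = convex hull t"
    by (intro closure_closed compact_imp_closed finite_imp_compact_convex_hull)
  then have "rel_frontier (convex hull t) = convex hull t - interior (convex hull t)"
    unfolding rel_frontier_def using rel_interior_nonempty_interior[OF ne] by simp
  then show "convex hull t - interior (convex hull t) = (\<Union>v\<in>t. convex hull (t - {v}))"
    using rel_frontier_convex_hull_cases[OF ind] by auto
qed

lemma generic_in_interior:
  assumes x: "generic V x" and t: "t \<in> simplices X 4" "x \<in> convex hull t"
  shows "x \<in> interior (convex hull t)"
proof (rule ccontr)
  assume "x \<notin> interior (convex hull t)"
  then obtain v where v: "v \<in> t" "x \<in> convex hull (t - {v})" using interior_tetrahedron(2)[OF t(1)] t(2) by blast
  have "card (t - {v}) \<le> 3" "t - {v} \<subseteq> V" using v t by auto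
  then show False using generic_convex[OF x] v by blast
qed

text \<open>Some vertex of \<open>t\<close> is missing from \<open>g\<close>, so every common point
  lies in a facet of \<open>t\<close>.\<close>

lemma interior_disjoint_triangle:
  assumes t: "t \<in> simplices X 4" and g: "g \<in> simplices X 3"
  shows "interior (convex hull t) \<inter> convex hull g = {}"
proof (rule ccontr)
  assume "\<not> ?thesis"
  then obtain y where y: "y \<in> interior (convex hull t)" "y \<in> convex hull g" by blast
  then have yt: "y \<in> convex hull t" using interior_subset by blast
  have "\<not> t \<subseteq> g"
  proof
    assume "t \<subseteq> g"
    then have "card t \<le> card g" using g finite_face by (intro card_mono) auto
    then show False using t g by simp
  qed
  then obtain v where v: "v \<in> t" "v \<notin> g" by blast
  have "y \<in> convex hull (t \<inter> g)" using hull_Int[of t g] t g y yt by blast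
  moreover have "t \<inter> g \<subseteq> t - {v}" using v by blast
  ultimately have "y \<in> convex hull (t - {v})" using hull_mono by blast
  then show False using interior_tetrahedron(2)[OF t] v y by blast
qed

section \<open>Three-cycles, cofaces of a triangle, and the filling of two-cycles\<close>

text \<open>At a generic interior point of \<open>t\<close>, the cone count of the boundary of
  \<open>a\<close> equals \<open>a t\<close>; it vanishes with the boundary.\<close>

lemma no_3_cycles:
  assumes cyc: "\<And>f. f \<in> simplices X 3 \<Longrightarrow> bdry X a f = 0" and t: "t \<in> simplices X 4"
  shows "a t = 0"
proof -
  obtain x where x: "x \<in> interior (convex hull t)" "generic V x"
    using generic_exists[OF finite_V open_interior interior_tetrahedron(1)[OF t]] .
  obtain p where p: "p \<notin> V" "generic (insert p V) x"
    using generic_apex_exists[OF finite_V x(2) open_UNIV] by blast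
  have xt: "x \<in> convex hull t" using x(1) interior_subset by blast
  have "a t = (\<Sum>s\<in>simplices X 4. a s * hull_ind s x)" using sum_tetrahedra[OF x(2) t xt] by simp
  also have "\<dots> = cone_count X (bdry X a) p x" using cone_count_bdry[OF finite_X closed_X p] by simp
  also have "\<dots> = 0" unfolding cone_count_def using cyc by (intro sum.neutral) auto
  finally show ?thesis .
qed

text \<open>Both ends are chosen near a relative interior point \<open>y\<close> of
  \<open>f\<close>, in a ball missing the other triangles: \<open>x\<close> generically, and
  \<open>x'\<close> in the tetrahedron over \<open>f\<close> whose apex is the reflection of
  \<open>x\<close> in \<open>y\<close>.\<close>

lemma segment_through_triangle:
  assumes f: "f \<in> simplices X 3"
  obtains x x' where "generic V x" "generic (insert x V) x'"
    "\<forall>g\<in>simplices X 3. closed_segment x x' \<inter> convex hull g \<noteq> {} \<longleftrightarrow> g = f"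
proof -
  have fX: "f \<in> X" "card f = 3" "finite f" "f \<noteq> {}" "\<not> affine_dependent f" "f \<subseteq> V"
    using f finite_face independent by auto
  obtain y where y: "y \<in> rel_interior (convex hull f)"
    using rel_interior_eq_empty[OF convex_convex_hull, of f] fX(4) by auto
  have yf: "y \<in> convex hull f" using y rel_interior_subset by blast
  \<comment> \<open>A common point of two different triangles lies in a proper face of
    \<open>f\<close>, while \<open>y\<close> is in its relative interior.\<close>
  have y_notin: "y \<notin> convex hull g" if g: "g \<in> simplices X 3" "g \<noteq> f" for g
  proof
    assume "y \<in> convex hull g"
    then have "y \<in> convex hull (f \<inter> g)" using hull_Int[of f g] fX g yf by blast
    moreover have "\<not> f \<subseteq> g" using card_subset_eq[of g f] g fX finite_face by auto
    then obtain v where v: "v \<in> f" "v \<notin> g" by blast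
    moreover have "f \<inter> g \<subseteq> f - {v}" using v by blast
    ultimately have "y \<in> convex hull (f - {v})" using hull_mono by blast
    then have "y \<in> rel_frontier (convex hull f)"
      unfolding rel_frontier_convex_hull_cases[OF fX(5)] using v by blast
    then show False using y by (simp add: rel_frontier_def)
  qed
  have "closed (\<Union>g\<in>simplices X 3 - {f}. convex hull g)"
    using finite_X finite_face
    by (intro closed_UN) (auto intro!: compact_imp_closed finite_imp_compact_convex_hull)
  then have "open (- (\<Union>g\<in>simplices X 3 - {f}. convex hull g))" by (rule open_Compl)
  moreover have "y \<in> - (\<Union>g\<in>simplices X 3 - {f}. convex hull g)" using y_notin by blast
  ultimately obtain \<delta> where \<delta>: "\<delta> > 0" "ball y \<delta> \<subseteq> - (\<Union>g\<in>simplices X 3 - {f}. convex hull g)"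
    using openE by blast
  have ballne: "ball y \<delta> \<noteq> {}" using \<delta>(1) by simp
  obtain x where x: "x \<in> ball y \<delta>" "generic V x" using generic_exists[OF finite_V open_ball ballne] .
  define q where "q = 2 *\<^sub>R y - x"
  have xf: "x \<notin> affine hull f" using genericD[OF x(2) fX(6)] fX(2) by simp
  have y_aff: "y \<in> affine hull f" using yf convex_hull_subset_affine_hull by blast
  have qf: "q \<notin> affine hull f"
  proof
    assume q: "q \<in> affine hull f"
    have "2 *\<^sub>R y + (- 1) *\<^sub>R q \<in> affine hull f" by (rule mem_affine[OF affine_affine_hull y_aff q]) simp
    then show False using xf by (simp add: q_def)
  qed
  have "\<not> affine_dependent (insert q f)" using affine_independent_insert[OF fX(5) qf] .
  moreover have "q \<notin> f" using qf hull_inc by metis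
  then have "card (insert q f) = Suc DIM(pt)" using fX by simp
  ultimately have ne: "interior (convex hull (insert q f)) \<noteq> {}"
    using interior_convex_hull_eq_empty by blast
  have "y \<in> convex hull (insert q f)" using yf hull_mono[of f "insert q f"] by blast
  \<comment> \<open>Interior points of this tetrahedron come arbitrarily close to \<open>y\<close>,
    so one can be chosen in the ball.\<close>
  then have "y \<in> closure (interior (convex hull (insert q f)))"
    unfolding convex_closure_interior[OF convex_convex_hull ne] using closure_subset by blast
  moreover have "y \<in> ball y \<delta>" using \<delta>(1) by simp
  ultimately have "ball y \<delta> \<inter> interior (convex hull (insert q f)) \<noteq> {}"
    using open_Int_closure_eq_empty[OF open_ball] by blast
  moreover have "open (ball y \<delta> \<inter> interior (convex hull (insert q f)))" by auto
  moreover have "finite (insert x V)" using finite_V by simp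
  ultimately obtain x' where x': "x' \<in> ball y \<delta>" "x' \<in> interior (convex hull (insert q f))" "generic (insert x V) x'"
    using generic_exists by (metis IntE)
  have "x' \<in> convex hull (insert q f)" using x'(2) interior_subset by blast
  then obtain u v b where uv: "u \<ge> 0" "v \<ge> 0" "u + v = 1" "b \<in> convex hull f" "x' = u *\<^sub>R q + v *\<^sub>R b"
    unfolding convex_hull_insert[OF fX(4)] by blast
  \<comment> \<open>The crossing point: in \<open>u x + x'\<close> the terms in \<open>x\<close>
    cancel because \<open>q = 2 y - x\<close>, which leaves a combination of \<open>y\<close> and
    \<open>b\<close>.\<close>
  define m where "m = (u / (1 + u)) *\<^sub>R x + (1 / (1 + u)) *\<^sub>R x'"
  have pos: "1 + u > 0" using uv by simp
  have m_alt: "m = (2 * u / (1 + u)) *\<^sub>R y + (v / (1 + u)) *\<^sub>R b"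
  proof -
    have "u *\<^sub>R x + x' = (2 * u) *\<^sub>R y + v *\<^sub>R b" by (simp add: uv(5) q_def algebra_simps)
    then have "(1 / (1 + u)) *\<^sub>R (u *\<^sub>R x + x') = (1 / (1 + u)) *\<^sub>R ((2 * u) *\<^sub>R y + v *\<^sub>R b)" by simp
    then show ?thesis by (simp add: m_def scaleR_add_right)
  qed
  have "2 * u / (1 + u) + v / (1 + u) = (2 * u + v) / (1 + u)" by (simp add: add_divide_distrib)
  also have "\<dots> = 1" using uv(3) pos by (simp add: field_simps)
  finally have sum1: "2 * u / (1 + u) + v / (1 + u) = 1" .
  have "m \<in> convex hull f"
    unfolding m_alt using uv pos sum1 yf by (intro convexD[OF convex_convex_hull]) auto
  moreover have "m \<in> closed_segment x x'"
  proof -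
    have "1 - 1 / (1 + u) = u / (1 + u)" using pos by (simp add: field_simps)
    then have "m = (1 - 1 / (1 + u)) *\<^sub>R x + (1 / (1 + u)) *\<^sub>R x'" by (simp add: m_def)
    then show ?thesis unfolding closed_segment_def using uv(1) by (intro CollectI exI[of _ "1 / (1 + u)"]) auto
  qed
  ultimately have meets: "closed_segment x x' \<inter> convex hull f \<noteq> {}" by blast
  have "closed_segment x x' \<subseteq> ball y \<delta>" using closed_segment_subset[OF x(1) x'(1) convex_ball] .
  then have "closed_segment x x' \<inter> convex hull g = {}" if "g \<in> simplices X 3" "g \<noteq> f" for g
    using \<delta>(2) that by blast
  then have "\<forall>g\<in>simplices X 3. closed_segment x x' \<inter> convex hull g \<noteq> {} \<longleftrightarrow> g = f"
    using meets by blast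
  then show thesis by (rule that[OF x(2) x'(3)])
qed

text \<open>Every tetrahedron on \<open>f\<close> contains an end of a segment that crosses
  \<open>f\<close> alone, and each end, being generic, lies in at most one tetrahedron.\<close>

lemma card_cofaces_triangle:
  assumes f: "f \<in> simplices X 3"
  shows "card (cofaces X f) \<le> 2"
proof -
  obtain x x' where x: "generic V x" and x': "generic (insert x V) x'"
    and seg: "\<forall>g\<in>simplices X 3. closed_segment x x' \<inter> convex hull g \<noteq> {} \<longleftrightarrow> g = f"
    using segment_through_triangle[OF f] .
  note cross = cone_count_crossing[OF finite_X closed_X x x']
  have x'V: "generic V x'" by (rule generic_mono[OF x']) auto
  have hits: "x \<in> convex hull t \<or> x' \<in> convex hull t" if t: "t \<in> cofaces X f" for t
  proof (rule ccontr)
    assume no: "\<not> ?thesis"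
    \<comment> \<open>If \<open>t\<close> contained neither end, the cone counts of its boundary
      would vanish at both. But they differ by the coefficient of \<open>f\<close> in that boundary,
      which is 1.\<close>
    let ?d = "\<lambda>s. of_bool (s = t) :: bit"
    have tX: "t \<in> X" "f \<subset> t" "card t = Suc (card f)" using t by (auto simp: cofaces_def)
    have "(\<Sum>s\<in>simplices X 4. ?d s * hull_ind s w) = 0" if "w \<notin> convex hull t" for w
      using that by (intro sum.neutral) (auto simp: hull_ind_def)
    then have "cone_count X (bdry X ?d) (2 *\<^sub>R x - x') x = 0" "cone_count X (bdry X ?d) (2 *\<^sub>R x - x') x' = 0"
      using cone_count_bdry[OF finite_X closed_X cross(1,2)] cone_count_bdry[OF finite_X closed_X cross(1,3)] no by auto
    then have "(\<Sum>g\<in>simplices X 3. bdry X ?d g * of_bool (closed_segment x x' \<inter> convex hull g \<noteq> {})) = 0"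
      using cross(4)[of "bdry X ?d"] by simp
    moreover have "(\<Sum>g\<in>simplices X 3. bdry X ?d g * of_bool (closed_segment x x' \<inter> convex hull g \<noteq> {}))
        = (\<Sum>g\<in>simplices X 3. if g = f then bdry X ?d g else 0)"
      using seg by (intro sum.cong) auto
    moreover have "\<dots> = bdry X ?d f" using finite_X f by (simp add: sum.delta)
    moreover have "bdry X ?d f = 1" using bdry_single[OF finite_X tX(1)] tX by simp
    ultimately show False by simp
  qed
  have one: "card {t \<in> cofaces X f. w \<in> convex hull t} \<le> 1" if "generic V w" for w
  proof -
    have "s = t" if "s \<in> {t \<in> cofaces X f. w \<in> convex hull t}" "t \<in> {t \<in> cofaces X f. w \<in> convex hull t}" for s t
      using generic_tetrahedron_unique[OF \<open>generic V w\<close>, of s t] that by (auto simp: cofaces_def)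
    then show ?thesis using finite_cofaces[OF finite_X, of f] by (intro card_le_Suc0_iff_eq[THEN iffD2, folded One_nat_def]) auto
  qed
  have "cofaces X f \<subseteq> {t \<in> cofaces X f. x \<in> convex hull t} \<union> {t \<in> cofaces X f. x' \<in> convex hull t}"
    using hits by blast
  then have "card (cofaces X f) \<le> card ({t \<in> cofaces X f. x \<in> convex hull t} \<union> {t \<in> cofaces X f. x' \<in> convex hull t})"
    using finite_cofaces[OF finite_X, of f] by (intro card_mono) auto
  also have "\<dots> \<le> 1 + 1" by (rule order_trans[OF card_Un_le add_mono[OF one[OF x] one[OF x'V]]])
  finally show ?thesis by simp
qed

text \<open>For a 2-cycle \<open>z\<close> this is the winding number modulo two of \<open>z\<close> around \<open>x\<close>; the chosen apex is
  irrelevant.\<close>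

definition winding :: "(pt set \<Rightarrow> bit) \<Rightarrow> pt \<Rightarrow> bit" where
  "winding z x = cone_count X z (SOME p. p \<notin> V \<and> generic (insert p V) x) x"

context
  fixes z assumes cycle: "\<And>e. e \<in> simplices X 2 \<Longrightarrow> bdry X z e = 0"
begin

lemma winding_eq:
  assumes "p \<notin> V" "generic (insert p V) x"
  shows "winding z x = cone_count X z p x"
proof -
  have "\<exists>p. p \<notin> V \<and> generic (insert p V) x" using assms by blast
  then have "(SOME p. p \<notin> V \<and> generic (insert p V) x) \<notin> V \<and> generic (insert (SOME p. p \<notin> V \<and> generic (insert p V) x) V) x"
    by (rule someI_ex)
  then show ?thesis unfolding winding_def using cone_count_apex[OF finite_X closed_X cycle] assms by blast
qed

text \<open>Both points are joined inside \<open>U\<close> to a third point, generic with respect to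
  both; these segments cross no triangle.\<close>

lemma winding_const:
  assumes U: "open U" "convex U" and disj: "\<And>g. g \<in> simplices X 3 \<Longrightarrow> U \<inter> convex hull g = {}"
    and x: "x \<in> U" "generic V x" and y: "y \<in> U" "generic V y"
  shows "winding z x = winding z y"
proof -
  have "finite (insert x (insert y V))" "U \<noteq> {}" using finite_V x by auto
  then obtain w where w: "w \<in> U" "generic (insert x (insert y V)) w"
    using generic_exists[OF _ U(1)] by blast
  have "winding z s = winding z w" if s: "s \<in> {x, y}" for s
  proof -
    have sg: "s \<in> U" "generic V s" "generic (insert s V) w"
      using s x y by (auto intro: generic_mono[OF w(2)])
    note cross = cone_count_crossing[OF finite_X closed_X sg(2,3)]
    have "closed_segment s w \<subseteq> U" using closed_segment_subset[OF sg(1) w(1) U(2)] .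
    then have no: "closed_segment s w \<inter> convex hull g = {}" if "g \<in> simplices X 3" for g using disj[OF that] by blast
    have "winding z s + winding z w = (\<Sum>f\<in>simplices X 3. z f * of_bool (closed_segment s w \<inter> convex hull f \<noteq> {}))"
      using winding_eq[OF cross(1,2)] winding_eq[OF cross(1,3)] cross(4) by simp
    also have "\<dots> = 0" using no by (intro sum.neutral) auto
    finally show ?thesis by (simp add: bit_add_eq_0_iff)
  qed
  then show ?thesis by auto
qed

text \<open>Far away the winding number is zero: \<open>w\<close> lies outside a ball containing
  \<open>V\<close> and the apex, hence outside all cones. Connectedness of the complement carries
  this to \<open>x\<close>.\<close>

lemma winding_outside:
  assumes conn: "connected (- (\<Union>C\<in>X. convex hull C))" and x: "x \<notin> (\<Union>C\<in>X. convex hull C)" "generic V x"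
  shows "winding z x = 0"
proof -
  define S where "S = - (\<Union>C\<in>X. convex hull C)"
  have openS: "open S"
    unfolding S_def using finite_X finite_face
    by (intro open_Compl closed_UN) (auto intro!: compact_imp_closed finite_imp_compact_convex_hull)
  obtain B where B: "B > 0" "V \<subseteq> ball 0 B"
    using bounded_subset_ballD[OF finite_imp_bounded[OF finite_V], of 0] by auto
  have hull_B: "convex hull C \<subseteq> ball 0 B" if "C \<subseteq> ball 0 B" for C :: "pt set"
    by (rule hull_minimal[where S = convex, OF that convex_ball])
  have "- cball 0 B \<noteq> ({} :: pt set)"
    by (metis Compl_empty_eq bounded_cball compl_le_compl_iff double_compl not_bounded_UNIV)
  then obtain w where w: "w \<in> - cball 0 B" "generic V w"
    using generic_exists[OF finite_V open_Compl[OF closed_cball]] by blast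
  have outside: "w \<notin> ball 0 B" using w(1) by auto
  have "ball 0 B \<noteq> ({} :: pt set)" using B(1) by simp
  then obtain p where p: "p \<in> ball 0 B" "p \<notin> V" "generic (insert p V) w"
    using generic_apex_exists[OF finite_V w(2) open_ball] by blast
  have "hull_ind (insert p f) w = 0" if "f \<in> simplices X 3" for f
  proof -
    have "insert p f \<subseteq> ball 0 B" using that p(1) B(2) by blast
    then have "w \<notin> convex hull (insert p f)" using outside hull_B by blast
    then show ?thesis by (simp add: hull_ind_def)
  qed
  then have "cone_count X z p w = 0" unfolding cone_count_def by (intro sum.neutral) auto
  then have w0: "winding z w = 0" using winding_eq[OF p(2,3)] by simp
  have "w \<notin> convex hull C" if "C \<in> X" for C
  proof -
    have "C \<subseteq> ball 0 B" using that B(2) by blast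
    then show ?thesis using hull_B outside by blast
  qed
  then have wS: "w \<in> S" unfolding S_def by blast
  \<comment> \<open>The induction principle asks for local constancy only among points satisfying
    \<open>P\<close>, here the generic ones, provided that every nonempty open part contains such a
    point.\<close>
  show ?thesis
  proof (rule connected_induction[where S = S and P = "generic V" and Q = "\<lambda>y. winding z y = 0" and a = w and b = x])
    fix T a assume "openin (top_of_set S) T" "a \<in> T"
    then have "open T" "T \<noteq> {}" using openin_open_eq[OF openS] by auto
    then show "\<exists>y. y \<in> T \<and> generic V y" using generic_exists[OF finite_V] by metis
  next
    fix a assume "a \<in> S"
    then obtain e where e: "e > 0" "ball a e \<subseteq> S" by (rule openE[OF openS])
    have "winding z s = winding z t" if "s \<in> ball a e" "t \<in> ball a e" "generic V s" "generic V t" for s t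
    proof (rule winding_const[OF open_ball convex_ball])
      show "ball a e \<inter> convex hull g = {}" if "g \<in> simplices X 3" for g using e(2) that unfolding S_def by blast
    qed (use that in auto)
    then show "\<exists>T. openin (top_of_set S) T \<and> a \<in> T \<and>
        (\<forall>x\<in>T. \<forall>y\<in>T. generic V x \<and> generic V y \<and> winding z x = 0 \<longrightarrow> winding z y = 0)"
      using e openin_open_eq[OF openS] by (intro exI[of _ "ball a e"] conjI ballI impI) auto
  next
    show "connected S" "x \<in> S" using conn x(1) unfolding S_def by blast+
  qed (use wS x w w0 in auto)
qed

text \<open>Each tetrahedron gets the winding number of a generic point in its interior as
  coefficient. Then the boundary of \<open>a\<close> has the same cone counts as \<open>z\<close> at
  generic points, and a segment crossing \<open>f\<close> alone shows that their coefficients at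
  \<open>f\<close> agree.\<close>

lemma fill_2_cycle:
  assumes conn: "connected (- (\<Union>C\<in>X. convex hull C))"
  shows "\<exists>a. \<forall>f\<in>simplices X 3. bdry X a f = z f"
proof -
  define a where "a t = winding z (SOME x. x \<in> interior (convex hull t) \<and> generic V x)" for t
  have wind: "winding z x = (\<Sum>t\<in>simplices X 4. a t * hull_ind t x)" if x: "generic V x" for x
  proof (cases "\<exists>t\<in>simplices X 4. x \<in> convex hull t")
    case True
    then obtain t where t: "t \<in> simplices X 4" "x \<in> convex hull t" by blast
    define y where "y = (SOME x. x \<in> interior (convex hull t) \<and> generic V x)"
    have xi: "x \<in> interior (convex hull t)" using generic_in_interior[OF x t] .
    then have "\<exists>x. x \<in> interior (convex hull t) \<and> generic V x" using x by blast
    then have y: "y \<in> interior (convex hull t) \<and> generic V y" unfolding y_def by (rule someI_ex)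
    have "winding z x = winding z y"
    proof (rule winding_const[OF open_interior])
      show "convex (interior (convex hull t))" by (simp add: convex_interior)
      show "interior (convex hull t) \<inter> convex hull g = {}" if "g \<in> simplices X 3" for g
        using interior_disjoint_triangle[OF t(1) that] .
    qed (use x xi y in auto)
    then show ?thesis using sum_tetrahedra[OF x t, of a] by (simp add: a_def y_def)
  next
    case False
    then have "x \<notin> (\<Union>C\<in>X. convex hull C)" using generic_in_tetrahedron[OF x] by blast
    then have "winding z x = 0" using winding_outside[OF conn _ x] by blast
    moreover have "(\<Sum>t\<in>simplices X 4. a t * hull_ind t x) = 0"
      using False by (intro sum.neutral) (auto simp: hull_ind_def)
    ultimately show ?thesis by simp
  qed
  have "bdry X a f = z f" if f: "f \<in> simplices X 3" for f
  proof -
    let ?c = "\<lambda>g. bdry X a g + z g"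
    obtain x x' where x: "generic V x" and x': "generic (insert x V) x'"
      and seg: "\<forall>g\<in>simplices X 3. closed_segment x x' \<inter> convex hull g \<noteq> {} \<longleftrightarrow> g = f"
      using segment_through_triangle[OF f] .
    note cross = cone_count_crossing[OF finite_X closed_X x x']
    have x'V: "generic V x'" by (rule generic_mono[OF x']) auto
    have zero: "cone_count X ?c p s = 0" if "p \<notin> V" "generic (insert p V) s" "generic V s" for p s
      using cone_count_bdry[OF finite_X closed_X that(1,2)] winding_eq[OF that(1,2)] wind[OF that(3)]
      by (simp add: cone_count_add)
    have "0 = cone_count X ?c (2 *\<^sub>R x - x') x + cone_count X ?c (2 *\<^sub>R x - x') x'"
      using zero[OF cross(1,2) x] zero[OF cross(1,3) x'V] by simp
    also have "\<dots> = (\<Sum>g\<in>simplices X 3. ?c g * of_bool (closed_segment x x' \<inter> convex hull g \<noteq> {}))"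
      by (rule cross(4))
    also have "\<dots> = (\<Sum>g\<in>simplices X 3. if g = f then ?c g else 0)"
      using seg by (intro sum.cong) auto
    also have "\<dots> = ?c f" using finite_X f by (simp add: sum.delta)
    finally show ?thesis by (metis bit_add_eq_0_iff)
  qed
  then show ?thesis by blast
qed

end

end

section \<open>Vertex sets of the cells\<close>

text \<open>An affinely independent set consists of the extreme points of its hull.\<close>

lemma convex_hull_independent_inj:
  fixes C D :: "'a::euclidean_space set"
  assumes "\<not> affine_dependent C" "\<not> affine_dependent D" "convex hull C = convex hull D"
  shows "C = D"
proof -
  have "x \<in> C \<longleftrightarrow> x \<in> D" for x
    using extreme_point_of_convex_hull_affine_independent[OF assms(1), of x]
      extreme_point_of_convex_hull_affine_independent[OF assms(2), of x] assms(3) by simp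
  then show ?thesis by blast
qed

definition vertex_sets :: "pt set set \<Rightarrow> pt set set" where
  "vertex_sets K = {C. C \<noteq> {} \<and> \<not> affine_dependent C \<and> convex hull C \<in> K}"

context
  fixes K X :: "pt set set"
  assumes complex: "simplicial_complex K" and X_def: "X = vertex_sets K"
begin

lemma hull_inj: "inj_on (\<lambda>C. convex hull C) X"
  by (rule inj_onI) (simp add: X_def vertex_sets_def convex_hull_independent_inj)

lemma vertex_setsD: "C \<in> X \<Longrightarrow> \<not> affine_dependent C \<and> convex hull C \<in> K \<and> C \<noteq> {} \<and> finite C"
  by (auto simp: X_def vertex_sets_def aff_independent_finite)

lemma face_in_K: "S \<in> K \<Longrightarrow> F face_of S \<Longrightarrow> F \<in> K"
  using complex unfolding simplicial_complex_def by blast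

lemma vertex_sets_subset:
  assumes "S \<in> X" "R \<subseteq> S" "R \<noteq> {}"
  shows "R \<in> X"
proof -
  have S: "\<not> affine_dependent S" "convex hull S \<in> K" using vertex_setsD[OF assms(1)] by auto
  have "convex hull R face_of convex hull S"
    unfolding face_of_convex_hull_affine_independent[OF S(1)] using assms(2) by blast
  then have "convex hull R \<in> K" using face_in_K[OF S(2)] by blast
  moreover have "\<not> affine_dependent R" using affine_independent_subset[OF S(1) assms(2)] .
  ultimately show ?thesis using assms(3) by (simp add: X_def vertex_sets_def)
qed

lemma hull_image: "(\<lambda>C. convex hull C) ` X = cells K"
proof (intro equalityI subsetI)
  fix S assume "S \<in> (\<lambda>C. convex hull C) ` X"
  then show "S \<in> cells K" by (auto simp: cells_def X_def vertex_sets_def)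
next
  fix S assume S: "S \<in> cells K"
  then have "S \<in> K" "S \<noteq> {}" by (auto simp: cells_def)
  then obtain C where "\<not> affine_dependent C" "S = convex hull C"
    using complex unfolding simplicial_complex_def simplex_def by blast
  with \<open>S \<in> K\<close> \<open>S \<noteq> {}\<close> have "C \<in> X" "S = convex hull C" by (auto simp: X_def vertex_sets_def)
  then show "S \<in> (\<lambda>C. convex hull C) ` X" by blast
qed

lemma cellE:
  assumes "S \<in> K" "S \<noteq> {}"
  obtains C where "C \<in> X" "S = convex hull C"
proof -
  have "S \<in> (\<lambda>C. convex hull C) ` X" unfolding hull_image using assms by (simp add: cells_def)
  then show thesis using that by blast
qed

lemma vertex_sets_geometric: "geometric_complex X"
proof
  have "finite K" using complex by (simp add: simplicial_complex_def)
  then have "finite (cells K)" by (simp add: cells_def)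
  then show "finite X" unfolding hull_image[symmetric] using finite_imageD[OF _ hull_inj] by blast
  show "face_closed X"
    unfolding face_closed_def using vertex_setsD vertex_sets_subset by blast
  show "\<not> affine_dependent C" if "C \<in> X" for C using vertex_setsD[OF that] by blast
  \<comment> \<open>The common face is spanned by a subset of \<open>C\<close> and also by a subset
    of \<open>D\<close>. By injectivity of hulls these subsets coincide, hence lie in
    \<open>C \<inter> D\<close>.\<close>
  show "convex hull C \<inter> convex hull D = convex hull (C \<inter> D)" if C: "C \<in> X" and D: "D \<in> X" for C D
  proof
    have ind: "\<not> affine_dependent C" "\<not> affine_dependent D" and inK: "convex hull C \<in> K" "convex hull D \<in> K"
      using vertex_setsD[OF C] vertex_setsD[OF D] by auto
    have face: "S \<inter> S' face_of S" if "S \<in> K" "S' \<in> K" for S S'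
      using complex that unfolding simplicial_complex_def by blast
    obtain c where c: "c \<subseteq> C" "convex hull C \<inter> convex hull D = convex hull c"
      using face[OF inK] unfolding face_of_convex_hull_affine_independent[OF ind(1)] by blast
    obtain d where d: "d \<subseteq> D" "convex hull D \<inter> convex hull C = convex hull d"
      using face[OF inK(2,1)] unfolding face_of_convex_hull_affine_independent[OF ind(2)] by blast
    have "convex hull c = convex hull d" using c(2) d(2) by (simp add: Int_commute)
    then have "c = d"
      by (rule convex_hull_independent_inj[OF affine_independent_subset[OF ind(1) c(1)]
          affine_independent_subset[OF ind(2) d(1)]])
    then have "c \<subseteq> C \<inter> D" using c d by blast
    then show "convex hull C \<inter> convex hull D \<subseteq> convex hull (C \<inter> D)" using c(2) hull_mono by metis
    show "convex hull (C \<inter> D) \<subseteq> convex hull C \<inter> convex hull D" by (simp add: hull_mono)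
  qed
qed

lemmas finite_vertex_sets = geometric_complex.finite_X[OF vertex_sets_geometric]
lemmas hull_Int_vertex_sets = geometric_complex.hull_Int[OF vertex_sets_geometric]

lemma hull_eq_iff: "C \<in> X \<Longrightarrow> D \<in> X \<Longrightarrow> convex hull C = convex hull D \<longleftrightarrow> C = D"
  using inj_on_eq_iff[OF hull_inj] by blast

lemma hull_subset_iff:
  assumes "C \<in> X" "D \<in> X"
  shows "convex hull C \<subseteq> convex hull D \<longleftrightarrow> C \<subseteq> D"
proof
  assume "convex hull C \<subseteq> convex hull D"
  then have "convex hull C = convex hull (C \<inter> D)" using hull_Int_vertex_sets[OF assms] by blast
  moreover have "\<not> affine_dependent C" "\<not> affine_dependent (C \<inter> D)"
    using vertex_setsD[OF assms(1)] affine_independent_subset[of C "C \<inter> D"] by auto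
  ultimately have "C = C \<inter> D" using convex_hull_independent_inj by blast
  then show "C \<subseteq> D" by blast
qed (rule hull_mono)

lemma hull_psubset_iff: "C \<in> X \<Longrightarrow> D \<in> X \<Longrightarrow> convex hull C \<subset> convex hull D \<longleftrightarrow> C \<subset> D"
  using hull_subset_iff[of C D] hull_eq_iff[of C D] by blast

lemma aff_dim_hull: "C \<in> X \<Longrightarrow> aff_dim (convex hull C) = int (card C) - 1"
  using vertex_setsD[of C] affine_independent_iff_card[of C] by (simp add: aff_dim_convex_hull)

lemma K_of_dim: "{e \<in> K. aff_dim e = int k} = (\<lambda>C. convex hull C) ` simplices X (Suc k)"
proof (intro equalityI subsetI)
  fix e assume e: "e \<in> {e \<in> K. aff_dim e = int k}"
  then have "e \<noteq> {}" by auto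
  then obtain C where C: "C \<in> X" "e = convex hull C" using cellE[of e] e by blast
  then have "card C = Suc k" using e aff_dim_hull[OF C(1)] by simp
  then show "e \<in> (\<lambda>C. convex hull C) ` simplices X (Suc k)" using C by blast
next
  fix e assume "e \<in> (\<lambda>C. convex hull C) ` simplices X (Suc k)"
  then obtain C where C: "C \<in> X" "card C = Suc k" "e = convex hull C" by blast
  then show "e \<in> {e \<in> K. aff_dim e = int k}" using aff_dim_hull[OF C(1)] vertex_setsD[OF C(1)] by simp
qed

lemma edges_eq: "edges K = (\<lambda>C. convex hull C) ` simplices X 2"
  using K_of_dim[of 1] by (simp add: edges_def numeral_2_eq_2)

lemma triangles_eq: "triangles K = (\<lambda>C. convex hull C) ` simplices X 3"
  using K_of_dim[of 2] by (simp add: triangles_def numeral_3_eq_3)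

lemma facet_in_edges:
  assumes "f \<in> simplices X 3" "v \<in> f"
  shows "f - {v} \<in> simplices X 2"
proof -
  have f: "f \<in> X" "card f = 3" using assms(1) by auto
  have "card (f - {v}) = 2" using f assms(2) by simp
  moreover from this have "f - {v} \<noteq> {}" by (metis card.empty zero_neq_numeral)
  ultimately show ?thesis using vertex_sets_subset[OF f(1), of "f - {v}"] by auto
qed

lemma boundary_edges_eq:
  assumes f: "f \<in> simplices X 3"
  shows "boundary_edges (convex hull f) = (\<lambda>v. convex hull (f - {v})) ` f"
proof (intro equalityI subsetI)
  have fX: "f \<in> X" "card f = 3" using f by auto
  have ind: "\<not> affine_dependent f" and fin: "finite f" using vertex_setsD[OF fX(1)] by auto
  {
    fix e assume "e \<in> boundary_edges (convex hull f)"
    then obtain c where c: "c \<subseteq> f" "e = convex hull c" "aff_dim e = 1"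
      unfolding boundary_edges_def face_of_convex_hull_affine_independent[OF ind] by blast
    have "c \<noteq> {}" using c by auto
    then have cX: "c \<in> X" using vertex_sets_subset[OF fX(1) c(1)] by blast
    then have "card c = 2" using aff_dim_hull[OF cX] c by simp
    then have "c \<in> {\<sigma>. \<sigma> \<subset> f \<and> card f = Suc (card \<sigma>)}" using c fX by auto
    then show "e \<in> (\<lambda>v. convex hull (f - {v})) ` f" unfolding facets_eq_image[OF fin] using c(2) by blast
  next
    fix e assume "e \<in> (\<lambda>v. convex hull (f - {v})) ` f"
    then obtain v where v: "v \<in> f" "e = convex hull (f - {v})" by blast
    have "f - {v} \<in> X" "card (f - {v}) = 2" using facet_in_edges[OF f v(1)] by auto
    then have "aff_dim e = 1" using aff_dim_hull v(2) by simp
    moreover have "e face_of convex hull f"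
      unfolding face_of_convex_hull_affine_independent[OF ind] using v(2) by blast
    ultimately show "e \<in> boundary_edges (convex hull f)" by (simp add: boundary_edges_def)
  }
qed

lemma singleton_in_iff: "{v} \<in> X \<longleftrightarrow> {v} \<in> K"
  by (simp add: X_def vertex_sets_def)

section \<open>Spanning trees and STT in terms of vertex sets\<close>

lemma adj_eq:
  assumes T: "T \<subseteq> simplices X 2"
  shows "adj ((\<lambda>C. convex hull C) ` T) = graph_rel T"
proof -
  have "closed_segment a b \<in> (\<lambda>C. convex hull C) ` T \<longleftrightarrow> {a, b} \<in> T" for a b
  proof
    assume "closed_segment a b \<in> (\<lambda>C. convex hull C) ` T"
    then obtain e where e: "e \<in> T" "convex hull {a, b} = convex hull e" by (auto simp: segment_convex_hull)
    have "e \<in> X" using e(1) T by blast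
    then have "{a, b} = e"
      using convex_hull_independent_inj[OF affine_independent_2 _ e(2)] vertex_setsD by blast
    then show "{a, b} \<in> T" using e by simp
  next
    assume "{a, b} \<in> T"
    then show "closed_segment a b \<in> (\<lambda>C. convex hull C) ` T" unfolding segment_convex_hull by blast
  qed
  then show ?thesis unfolding adj_def graph_rel_def by blast
qed

lemma spanning_tree_iff:
  assumes T: "T \<subseteq> simplices X 2"
  shows "spanning_tree K ((\<lambda>C. convex hull C) ` T) \<longleftrightarrow> abs_tree X T"
proof -
  have "(\<lambda>C. convex hull C) ` T \<subseteq> edges K" unfolding edges_eq using T by (rule image_mono)
  moreover have "has_cycle ((\<lambda>C. convex hull C) ` T) \<longleftrightarrow> cyclic_rel (graph_rel T)"
    unfolding has_cycle_def cyclic_rel_def adj_eq[OF T] ..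
  ultimately show ?thesis
    unfolding spanning_tree_def abs_tree_def adj_eq[OF T] vertices_def singleton_in_iff using T by auto
qed

lemma known_subset_edges:
  assumes "T \<subseteq> simplices X 2"
  shows "known X T \<subseteq> simplices X 2"
proof
  fix e assume "e \<in> known X T"
  then show "e \<in> simplices X 2"
  proof induction
    case (tree e)
    then show ?case using assms by blast
  next
    case (fill f v)
    then show ?case using facet_in_edges by blast
  qed
qed

text \<open>Each step removes a triangle from the list, so runs are finite. This supplies a stuck
  state to which \<open>stt_terminates\<close>, a statement about all reachable stuck states, can be
  applied.\<close>

lemma stt_step_stuck_exists:
  assumes "finite (snd s)"
  shows "\<exists>s'. (stt_step K)\<^sup>*\<^sup>* s s' \<and> \<not> (\<exists>s''. stt_step K s' s'')"
  using assms
proof (induction "card (snd s)" arbitrary: s rule: less_induct)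
  case less
  show ?case
  proof (cases "\<exists>s''. stt_step K s s''")
    case True
    then obtain s'' where step: "stt_step K s s''" by blast
    then obtain f e where "f \<in> snd s" "s'' = (insert e (fst s), snd s - {f})"
      unfolding stt_step_def by (elim bexE exE conjE)
    then have f: "f \<in> snd s" "snd s'' = snd s - {f}" by simp_all
    then have "card (snd s'') < card (snd s)" using less.prems by (metis card_Diff1_less)
    moreover have "finite (snd s'')" using f less.prems by simp
    ultimately obtain s' where "(stt_step K)\<^sup>*\<^sup>* s'' s'" "\<not> (\<exists>s''. stt_step K s' s'')" using less.hyps by blast
    then show ?thesis using step by (meson converse_rtranclp_into_rtranclp)
  next
    case False
    then show ?thesis by blast
  qed
qed

text \<open>The third clause says that a processed triangle has all its edges known, the fourth that
  STT never goes beyond the closure \<open>known\<close>.\<close>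

lemma stt_invariant:
  assumes T: "T \<subseteq> simplices X 2" and run: "(stt_step K)\<^sup>*\<^sup>* ((\<lambda>C. convex hull C) ` T, triangles K) s"
  shows "(\<lambda>C. convex hull C) ` T \<subseteq> fst s \<and> snd s \<subseteq> triangles K \<and>
    (\<forall>f\<in>triangles K - snd s. boundary_edges f \<subseteq> fst s) \<and> fst s \<subseteq> (\<lambda>C. convex hull C) ` known X T"
  using run
proof (induction rule: rtranclp_induct)
  case base
  then show ?case by (auto intro: known.tree)
next
  case (step s s')
  obtain f e1 e2 e where f: "f \<in> snd s" "boundary_edges f = {e1, e2, e}" "distinct [e1, e2, e]"
    "e1 \<in> fst s" "e2 \<in> fst s" and s': "s' = (insert e (fst s), snd s - {f})"
    using step.hyps(2) unfolding stt_step_def by (elim bexE exE conjE)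
  have fst_known: "fst s \<subseteq> (\<lambda>C. convex hull C) ` known X T" using step.IH by blast
  have "f \<in> triangles K" using f(1) step.IH by blast
  then obtain f0 where f0: "f0 \<in> simplices X 3" "f = convex hull f0" unfolding triangles_eq by blast
  have bd: "(\<lambda>v. convex hull (f0 - {v})) ` f0 = {e1, e2, e}" using boundary_edges_eq[OF f0(1)] f(2) f0(2) by simp
  then obtain v where v: "v \<in> f0" "e = convex hull (f0 - {v})" by blast
  have others: "f0 - {w} \<in> known X T" if w: "w \<in> f0" "w \<noteq> v" for w
  proof -
    have X: "f0 - {w} \<in> X" "f0 - {v} \<in> X" using facet_in_edges[OF f0(1)] w v by auto
    have "f0 - {w} \<noteq> f0 - {v}" using w v by blast
    then have "convex hull (f0 - {w}) \<noteq> e" using hull_eq_iff[OF X] v(2) by simp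
    moreover have "convex hull (f0 - {w}) \<in> {e1, e2, e}" unfolding bd[symmetric] using w(1) by (rule imageI)
    ultimately have "convex hull (f0 - {w}) \<in> fst s" using f(4,5) by auto
    then obtain c where c: "c \<in> known X T" "convex hull (f0 - {w}) = convex hull c" using fst_known by blast
    have "c \<in> X" using c(1) known_subset_edges[OF T] by blast
    then show ?thesis using hull_eq_iff[OF X(1)] c by metis
  qed
  have "f0 - {v} \<in> known X T" using known.fill[OF _ v(1) others] f0(1) by blast
  then have "fst s' \<subseteq> (\<lambda>C. convex hull C) ` known X T" using fst_known v(2) s' by auto
  moreover have "boundary_edges g \<subseteq> fst s'" if g: "g \<in> triangles K - snd s'" for g
  proof (cases "g = f")
    case True
    then show ?thesis using f(2,4,5) s' by simp
  next
    case False
    then have "g \<in> triangles K - snd s" using g s' by simp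
    then have "boundary_edges g \<subseteq> fst s" using step.IH by blast
    then show ?thesis using s' by auto
  qed
  moreover have "(\<lambda>C. convex hull C) ` T \<subseteq> fst s'" "snd s' \<subseteq> triangles K" using step.IH s' by auto
  ultimately show ?case by blast
qed

text \<open>A stuck state contains all of \<open>known\<close>, by rule induction: a triangle with
  two known edges either was processed, so that its third edge is known, or would allow another
  step.\<close>

lemma stt_terminates_iff:
  assumes T: "T \<subseteq> simplices X 2"
  shows "stt_terminates K ((\<lambda>C. convex hull C) ` T) \<longleftrightarrow> simplices X 2 \<subseteq> known X T"
proof
  assume terminates: "stt_terminates K ((\<lambda>C. convex hull C) ` T)"
  have "finite (triangles K)" unfolding triangles_eq using finite_vertex_sets by simp
  then obtain s where s: "(stt_step K)\<^sup>*\<^sup>* ((\<lambda>C. convex hull C) ` T, triangles K) s" "\<not> (\<exists>s''. stt_step K s s'')"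
    using stt_step_stuck_exists[of "((\<lambda>C. convex hull C) ` T, triangles K)"] by auto
  then have "edges K \<subseteq> fst s" using terminates unfolding stt_terminates_def by blast
  also have "\<dots> \<subseteq> (\<lambda>C. convex hull C) ` known X T" using stt_invariant[OF T s(1)] by blast
  finally have sub: "(\<lambda>C. convex hull C) ` simplices X 2 \<subseteq> (\<lambda>C. convex hull C) ` known X T" unfolding edges_eq .
  have "known X T \<subseteq> X" using known_subset_edges[OF T] by blast
  then show "simplices X 2 \<subseteq> known X T" using inj_on_image_subset_iff[OF hull_inj, of "simplices X 2" "known X T"] sub by blast
next
  assume all: "simplices X 2 \<subseteq> known X T"
  show "stt_terminates K ((\<lambda>C. convex hull C) ` T)"
    unfolding stt_terminates_def
  proof (intro allI impI)
    fix s assume s: "(stt_step K)\<^sup>*\<^sup>* ((\<lambda>C. convex hull C) ` T, triangles K) s \<and> \<not> (\<exists>s'. stt_step K s s')"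
    then have stuck: "\<not> (\<exists>s'. stt_step K s s')" by blast
    have inv: "(\<lambda>C. convex hull C) ` T \<subseteq> fst s" "\<forall>f\<in>triangles K - snd s. boundary_edges f \<subseteq> fst s"
      using stt_invariant[OF T, of s] s by blast+
    have "convex hull e \<in> fst s" if "e \<in> known X T" for e
      using that
    proof induction
      case (tree e)
      then show ?case using inv(1) by blast
    next
      case (fill f v)
      have f3: "f \<in> simplices X 3" using fill.hyps(1) by simp
      have bd: "boundary_edges (convex hull f) = (\<lambda>v. convex hull (f - {v})) ` f"
        using boundary_edges_eq[OF f3] .
      have tri: "convex hull f \<in> triangles K" unfolding triangles_eq using f3 by blast
      show ?case
      proof (cases "convex hull f \<in> snd s")
        case False
        then show ?thesis using inv(2) tri bd fill.hyps(2) by blast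
      next
        case True
        have "card (f - {v}) = 2" using fill.hyps by auto
        then obtain a b where ab: "f - {v} = {a, b}" "a \<noteq> b" by (auto simp: card_2_iff)
        then have fab: "f = {a, b, v}" "v \<noteq> a" "v \<noteq> b" using fill.hyps(2) by auto
        let ?E = "\<lambda>v. convex hull (f - {v})"
        have dist: "?E x \<noteq> ?E y" if "x \<in> f" "y \<in> f" "x \<noteq> y" for x y
        proof -
          have "f - {x} \<in> X" "f - {y} \<in> X" using facet_in_edges[OF f3] that by auto
          moreover have "f - {x} \<noteq> f - {y}" using that by blast
          ultimately show ?thesis using hull_eq_iff by blast
        qed
        have abf: "a \<in> f" "b \<in> f" using ab(1) by blast+
        then have "?E a \<noteq> ?E b" "?E a \<noteq> ?E v" "?E b \<noteq> ?E v"
          using dist fill.hyps(2) ab(2) fab(2,3) by blast+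
        then have "distinct [?E a, ?E b, ?E v]" by simp
        moreover have "boundary_edges (convex hull f) = {?E a, ?E b, ?E v}"
          unfolding bd by (subst (2) fab(1)) (simp only: image_insert image_empty)
        moreover have "?E a \<in> fst s" "?E b \<in> fst s" using fill.IH abf fab(2,3) by blast+
        ultimately have "stt_step K s (insert (?E v) (fst s), snd s - {convex hull f})"
          unfolding stt_step_def using True by blast
        then show ?thesis using stuck by blast
      qed
    qed
    then show "edges K \<subseteq> fst s" unfolding edges_eq using all by blast
  qed
qed

section \<open>Collapses in terms of vertex sets\<close>

text \<open>Taking hulls is an order isomorphism from \<open>X\<close> onto the cells and turns
  cardinality into dimension plus one, so free faces correspond.\<close>

lemma abs_collapse_imp_elementary:
  assumes "abs_collapse C C'" "C \<subseteq> X"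
  shows "elementary_collapse ((\<lambda>C. convex hull C) ` C) ((\<lambda>C. convex hull C) ` C') \<and> C' \<subseteq> X"
proof -
  let ?h = "\<lambda>C::pt set. convex hull C"
  obtain \<sigma> \<tau> where st: "\<sigma> \<in> C" "\<tau> \<in> C" "\<sigma> \<subset> \<tau>" "card \<tau> = Suc (card \<sigma>)"
    and free: "\<forall>\<rho>\<in>C. \<sigma> \<subset> \<rho> \<longrightarrow> \<rho> = \<tau>" and C': "C' = C - {\<sigma>, \<tau>}"
    using assms(1) unfolding abs_collapse_def by blast
  have stX: "\<sigma> \<in> X" "\<tau> \<in> X" using st assms(2) by auto
  have "elementary_collapse (?h ` C) (?h ` C')"
    unfolding elementary_collapse_def
  proof (intro exI conjI)
    show "?h \<sigma> \<in> ?h ` C" "?h \<tau> \<in> ?h ` C" using st by auto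
    show "?h \<sigma> \<subset> ?h \<tau>" using hull_psubset_iff[OF stX] st by blast
    show "aff_dim (?h \<sigma>) = aff_dim (?h \<tau>) - 1" using aff_dim_hull[OF stX(1)] aff_dim_hull[OF stX(2)] st by simp
    show "\<forall>\<rho>\<in>?h ` C. ?h \<sigma> \<subset> \<rho> \<longrightarrow> \<rho> = ?h \<tau>" using free hull_psubset_iff[OF stX(1)] assms(2) by blast
    have "?h ` (C - {\<sigma>, \<tau>}) = ?h ` C - ?h ` {\<sigma>, \<tau>}"
      by (rule inj_on_image_set_diff[OF hull_inj]) (use assms(2) stX in blast)+
    then show "?h ` C' = ?h ` C - {?h \<sigma>, ?h \<tau>}" by (simp only: C' image_insert image_empty)
  qed
  then show ?thesis using C' assms(2) by blast
qed

lemma elementary_collapse_imp_abs: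
  assumes "elementary_collapse ((\<lambda>C. convex hull C) ` C) D" "C \<subseteq> X"
  shows "\<exists>C'. abs_collapse C C' \<and> D = (\<lambda>C. convex hull C) ` C' \<and> C' \<subseteq> X"
proof -
  let ?h = "\<lambda>C::pt set. convex hull C"
  obtain s t where st': "s \<in> ?h ` C" "t \<in> ?h ` C" "s \<subset> t" "aff_dim s = aff_dim t - 1"
    and free': "\<forall>\<rho>\<in>?h ` C. s \<subset> \<rho> \<longrightarrow> \<rho> = t" and D: "D = ?h ` C - {s, t}"
    using assms(1) unfolding elementary_collapse_def by blast
  obtain \<sigma> \<tau> where st: "\<sigma> \<in> C" "\<tau> \<in> C" "s = ?h \<sigma>" "t = ?h \<tau>" using st'(1,2) by blast
  have stX: "\<sigma> \<in> X" "\<tau> \<in> X" using st assms(2) by auto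
  have "abs_collapse C (C - {\<sigma>, \<tau>})"
    unfolding abs_collapse_def
  proof (intro exI conjI)
    show "\<sigma> \<in> C" "\<tau> \<in> C" using st by auto
    show "\<sigma> \<subset> \<tau>" using hull_psubset_iff[OF stX] st'(3) st by blast
    show "card \<tau> = Suc (card \<sigma>)" using aff_dim_hull[OF stX(1)] aff_dim_hull[OF stX(2)] st'(4) st by simp
    show "\<forall>\<rho>\<in>C. \<sigma> \<subset> \<rho> \<longrightarrow> \<rho> = \<tau>"
    proof (intro ballI impI)
      fix \<rho> assume \<rho>: "\<rho> \<in> C" "\<sigma> \<subset> \<rho>"
      then have \<rho>X: "\<rho> \<in> X" using assms(2) by blast
      then have "?h \<rho> = ?h \<tau>" using free' hull_psubset_iff[OF stX(1) \<rho>X] \<rho> st by blast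
      then show "\<rho> = \<tau>" using hull_eq_iff[OF \<rho>X stX(2)] by simp
    qed
  qed simp
  moreover have "?h ` (C - {\<sigma>, \<tau>}) = ?h ` C - ?h ` {\<sigma>, \<tau>}"
    by (rule inj_on_image_set_diff[OF hull_inj]) (use assms(2) stX in blast)+
  then have "D = ?h ` (C - {\<sigma>, \<tau>})" by (simp only: D st(3,4) image_insert image_empty)
  ultimately show ?thesis using assms(2) by blast
qed

lemma collapsible_iff: "collapsible K \<longleftrightarrow> (\<exists>v. abs_collapse\<^sup>*\<^sup>* X {{v}})"
proof
  assume "collapsible K"
  then obtain v where run: "elementary_collapse\<^sup>*\<^sup>* ((\<lambda>C. convex hull C) ` X) {{v}}"
    unfolding collapsible_def hull_image by blast
  have "\<exists>C. abs_collapse\<^sup>*\<^sup>* X C \<and> D = (\<lambda>C. convex hull C) ` C \<and> C \<subseteq> X"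
    if "elementary_collapse\<^sup>*\<^sup>* ((\<lambda>C. convex hull C) ` X) D" for D
    using that
  proof (induction rule: rtranclp_induct)
    case base
    then show ?case by blast
  next
    case (step D D')
    then obtain C where C: "abs_collapse\<^sup>*\<^sup>* X C" "D = (\<lambda>C. convex hull C) ` C" "C \<subseteq> X" by blast
    then obtain C' where "abs_collapse C C'" "D' = (\<lambda>C. convex hull C) ` C'" "C' \<subseteq> X"
      using elementary_collapse_imp_abs step.hyps(2) by blast
    then show ?case using rtranclp.rtrancl_into_rtrancl[OF C(1)] by blast
  qed
  then obtain C where C: "abs_collapse\<^sup>*\<^sup>* X C" "{{v}} = (\<lambda>C. convex hull C) ` C" "C \<subseteq> X" using run by blast
  have "c = {v}" if "c \<in> C" for c
  proof -
    have "convex hull c = convex hull {v}" using C(2) that by auto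
    then show ?thesis using convex_hull_independent_inj[of c "{v}"] vertex_setsD[of c] that C(3) by auto
  qed
  moreover have "C \<noteq> {}" using C(2) by auto
  ultimately have "C = {{v}}" by blast
  then show "\<exists>v. abs_collapse\<^sup>*\<^sup>* X {{v}}" using C(1) by blast
next
  assume "\<exists>v. abs_collapse\<^sup>*\<^sup>* X {{v}}"
  then obtain v where run: "abs_collapse\<^sup>*\<^sup>* X {{v}}" by blast
  have "elementary_collapse\<^sup>*\<^sup>* ((\<lambda>C. convex hull C) ` X) ((\<lambda>C. convex hull C) ` C) \<and> C \<subseteq> X"
    if "abs_collapse\<^sup>*\<^sup>* X C" for C
    using that
  proof (induction rule: rtranclp_induct)
    case (step C C')
    then show ?case using abs_collapse_imp_elementary by (meson rtranclp.rtrancl_into_rtrancl)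
  qed simp
  then have "elementary_collapse\<^sup>*\<^sup>* (cells K) ((\<lambda>C. convex hull C) ` {{v}})" using run unfolding hull_image by blast
  then show "collapsible K" unfolding collapsible_def by auto
qed

end

section \<open>The equivalence for a triangulated ball\<close>

theorem theorem6:
  fixes K :: "(real^3) set set"
  assumes "simplicial_complex3 K"
    and "closed_bounded_domain (\<Union>K)"
    and "lipschitz_boundary (\<Union>K)"
    and "(\<Union>K) homeomorphic (cball (0::real^3) 1)"
  shows "(\<exists>T. spanning_tree K T \<and> stt_terminates K T) \<longleftrightarrow> collapsible K"
proof -
  have complex: "simplicial_complex K" using assms(1) by (simp add: simplicial_complex3_def)
  let ?X = "vertex_sets K" and ?h = "\<lambda>C::pt set. convex hull C"
  interpret geometric_complex ?X by (rule vertex_sets_geometric[OF complex refl])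
  have trees: "(\<exists>T. spanning_tree K T \<and> stt_terminates K T)
      \<longleftrightarrow> (\<exists>T. abs_tree ?X T \<and> simplices ?X 2 \<subseteq> known ?X T)"
  proof
    assume "\<exists>T. spanning_tree K T \<and> stt_terminates K T"
    then obtain T where T: "spanning_tree K T" "stt_terminates K T" by blast
    have "T \<subseteq> ?h ` simplices ?X 2" using T(1) unfolding spanning_tree_def edges_eq[OF complex refl] by blast
    then obtain T0 where T0: "T0 \<subseteq> simplices ?X 2" "T = ?h ` T0" by (rule subset_imageE)
    have "abs_tree ?X T0" using T(1) spanning_tree_iff[OF complex refl T0(1)] T0(2) by blast
    moreover have "simplices ?X 2 \<subseteq> known ?X T0" using T(2) stt_terminates_iff[OF complex refl T0(1)] T0(2) by blast
    ultimately show "\<exists>T. abs_tree ?X T \<and> simplices ?X 2 \<subseteq> known ?X T" by blast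
  next
    assume "\<exists>T. abs_tree ?X T \<and> simplices ?X 2 \<subseteq> known ?X T"
    then obtain T where T: "abs_tree ?X T" "simplices ?X 2 \<subseteq> known ?X T" by blast
    have sub: "T \<subseteq> simplices ?X 2" using T(1) by (simp add: abs_tree_def)
    show "\<exists>T. spanning_tree K T \<and> stt_terminates K T"
      using T spanning_tree_iff[OF complex refl sub] stt_terminates_iff[OF complex refl sub] by blast
  qed
  have union: "(\<Union>C\<in>?X. convex hull C) = \<Union>K"
    using hull_image[OF complex refl] by (auto simp: cells_def)
  \<comment> \<open>Here the ball enters: a homeomorphic copy of a compact convex set in three-space
    has connected complement.\<close>
  have conn: "connected (- (\<Union>C\<in>?X. convex hull C))"
    unfolding union using connected_complement_homeomorphic_convex_compact[OF assms(4)] by simp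
  obtain S where "S \<in> K" "aff_dim S = 3" using assms(1) by (auto simp: simplicial_complex3_def)
  then have "?X \<noteq> {}" using cellE[OF complex refl, of S] by force
  have "\<exists>v. abs_collapse\<^sup>*\<^sup>* ?X {{v}}" if "abs_tree ?X T" "simplices ?X 2 \<subseteq> known ?X T" for T
  proof (rule tree_imp_collapsible[OF finite_X closed_X])
    show "\<exists>a. \<forall>f\<in>simplices ?X 3. bdry ?X a f = z f" if "\<And>e. e \<in> simplices ?X 2 \<Longrightarrow> bdry ?X z e = 0" for z
      using fill_2_cycle[OF that conn] .
  qed (fact card_le_4 no_3_cycles card_cofaces_triangle that \<open>?X \<noteq> {}\<close>)+
  then show ?thesis
    unfolding trees collapsible_iff[OF complex refl] using collapsible_imp_tree[OF _ closed_X] by blast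
qed

end
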